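(* Let $m\ge1$ be an integer, let $(\mathcal M,+,0)$ be a commutative monoid, and let $S=(s_i)_{i\ge1}$ be a sequence in $\mathcal M$ that is periodic of period $m$, i.e. $s_{i+m}=s_i$ for all $i\ge1$. Put $S_i=s_1+\cdots+s_i$. Let $c_1,\dots,c_m,c_{\overline1},\dots,c_{\overline m}$ be commuting indeterminates (colors). Then \begin{align*} \sum_{\lambda\in \overline{\mathcal{P}}} \left(\prod_{j=1}^m c_j^{\rho_j(\lambda)}c_{\overline{j}}^{\rho_{\overline{j}}(\lambda)} \right)q^{|\lambda|_S} &= \frac{(-c_{\overline{1}} q^{S_1},\ldots,-c_{\overline{m}} q^{S_m};q^{S_m})_\infty}{(c_{1} q^{S_1},\ldots,c_{m} q^{S_m};q^{S_m})_\infty},\\ \sum_{\lambda\in \mathcal{P}} \left(\prod_{j=1}^m c_j^{\rho_j(\lambda)} \right) q^{|\lambda|_S} &= \frac{1}{(c_{1} q^{S_1},\ldots,c_{m} q^{S_m};q^{S_m})_\infty},\\ \sum_{\lambda\in \overline{\mathcal{F}}} \left(\prod_{j=1}^m c_{\overline{j}}^{\rho_{\overline{j}}(\lambda)} \right)q^{|\lambda|_S} &= (-c_{\overline{1}} q^{S_1},\ldots,-c_{\overline{m}} q^{S_m};q^{S_m})_\infty,\\ \sum_{\lambda\in \overline{\mathcal{D}}} \left(\prod_{j=1}^m c_j^{\rho_j(\lambda)}c_{\overline{j}}^{\rho_{\overline{j}}(\lambda)} \right)q^{|\lambda|_S} &=\sum_{n\geq 0} \sum_{\ell=1}^m \frac{(c_{\overline{1}}\cdots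 c_{\overline{\ell-1}})^{n+1} q^{(n+1)(S_1+\cdots+S_{\ell-1})+\frac{(\ell-1)n(n+1)}{2}S_m}}{(c_{1} q^{S_1},\ldots,c_{\ell-1} q^{S_{\ell-1}};q^{S_m})_{n+1}}\\ &\qquad\qquad\cdot\frac{(c_{\overline{\ell}}\cdots c_{\overline{m}})^{n} q^{n(S_{\ell}+\cdots+S_{m})+\frac{(m-\ell+1)n(n-1)}{2}S_m}}{(c_{\ell} q^{S_{\ell}},\ldots,c_{m} q^{S_m};q^{S_m})_{n}}. \end{align*}
   Context: Over-lined integers: $\overline{\mathbb{Z}_{\geq 1}}=\{\overline1,\overline2,\ldots\}$ is a disjoint copy of $\mathbb{Z}_{\ge 1}$; both $i$ and $\overline i$ have size $i$; sums, differences and multiples use sizes. Order: $0<\overline1<1<\overline2<2<\cdots$. An over-partition is an infinite non-increasing sequence $\lambda=(\lambda_i)_{i\ge1}$ of elements of $\mathbb{Z}_{\geq 0}\sqcup\overline{\mathbb{Z}_{\geq 1}}$ with finitely many nonzero terms, in which each over-lined integer occurs at most once. $\overline{\mathcal P}$: all over-partitions. $\mathcal P$: those without over-lined parts. $\overline{\mathcal D}$: those all of whose positive parts are over-lined. $\overline{\mathcal F}$: those $\lambda$ such that $\overline i$ is a part of $\lambda$ for all $\overline i\le\lambda_1$ (equivalently $\lambda_i-\lambda_{i+1}=\chi(\lambda_i\text{ is over-lined})$ for all $i$). Here $\chi(A)=1$ if $A$ is true and $0$ otherwise. $|\lambda|_S=\sum_{i\ge1}\lambda_i\cdot s_i\in\mathcal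 M$. For $1\le j\le m$, $$\rho_j(\lambda)=\sum_{i\ge0}\bigl(\lambda_{j+im}-\lambda_{j+1+im}-\chi(\lambda_{j+im}\text{ is over-lined})\bigr),\qquad \rho_{\overline j}(\lambda)=\#\{i\ge0:\lambda_{j+im}\text{ is over-lined}\}.$$ $q^a$ ($a\in\mathcal M$) are formal powers of $q$, with $q^aq^b=q^{a+b}$ and $q^0=1$. For $n\in\mathbb Z_{\ge0}\cup\{\infty\}$, $(a;q^{s})_n=\prod_{k=0}^{n-1}(1-a\,q^{k\cdot s})$ and $(a_1,\dots,a_j;q^s)_n=(a_1;q^s)_n\cdots(a_j;q^s)_n$. Empty products equal $1$.
   Formalization: The first three identities are stated under the condition that the left-hand sum exists (each monomial gets finitely many contributions); for a general monoid it may not, e.g. m=1 and s_i=0, where all partitions (1^k) contribute c_1. *)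

theory Defs
  imports "HOL-Analysis.Analysis" "HOL-Library.Poly_Mapping" "HOL-Library.Function_Algebras"
begin

section \<open>Over-lined integers\<close>

text \<open>\<open>Pl i\<close> is the integer $i \ge 0$ and \<open>Ov i\<close> its over-lined copy. The disjoint copy starts at
  $\overline 1$: \<open>Ov 0\<close> does not denote anything and is excluded from over-partitions below.
  The same type indexes the colors.\<close>

datatype oint = Pl nat | Ov nat

fun sz :: "oint \<Rightarrow> nat" where
  "sz (Pl i) = i"
| "sz (Ov i) = i"

fun overlined :: "oint \<Rightarrow> bool" where
  "overlined (Pl i) = False"
| "overlined (Ov i) = True"

instantiation oint :: linorder
begin

definition less_oint :: "oint \<Rightarrow> oint \<Rightarrow> bool" where
  "x < y \<longleftrightarrow> sz x < sz y \<or> (sz x = sz y \<and> overlined x \<and> \<not> overlined y)"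

definition less_eq_oint :: "oint \<Rightarrow> oint \<Rightarrow> bool" where
  "x \<le> y \<longleftrightarrow> x < y \<or> (x :: oint) = y"

instance
proof
  fix x y z :: oint
  show "(x < y) = (x \<le> y \<and> \<not> y \<le> x)"
    by (cases x; cases y) (auto simp: less_oint_def less_eq_oint_def)
  show "x \<le> x"
    by (simp add: less_eq_oint_def)
  show "x \<le> z" if "x \<le> y" "y \<le> z"
    using that by (cases x; cases y; cases z) (auto simp: less_oint_def less_eq_oint_def)
  show "x = y" if "x \<le> y" "y \<le> x"
    using that by (cases x; cases y) (auto simp: less_oint_def less_eq_oint_def)
  show "x \<le> y \<or> y \<le> x"
    by (cases x; cases y) (auto simp: less_oint_def less_eq_oint_def)
qed

end

section \<open>Over-partitions\<close>

text \<open>A sequence $(\lambda_i)_{i \ge 1}$ is a function on \<open>nat\<close>; its irrelevant value at index 0 is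
  fixed to \<open>Pl 0\<close>, so that each over-partition is represented by exactly one function.\<close>

definition overpartitions :: "(nat \<Rightarrow> oint) set" where
  "overpartitions = {lam. lam 0 = Pl 0
     \<and> (\<forall>i\<ge>1. lam i \<noteq> Ov 0)
     \<and> (\<forall>i\<ge>1. lam (i + 1) \<le> lam i)
     \<and> finite {i. i \<ge> 1 \<and> lam i \<noteq> Pl 0}
     \<and> (\<forall>i\<ge>1. \<forall>j\<ge>1. lam i = lam j \<and> overlined (lam i) \<longrightarrow> i = j)}"

definition partitions_P :: "(nat \<Rightarrow> oint) set" where
  "partitions_P = {lam \<in> overpartitions. \<forall>i\<ge>1. \<not> overlined (lam i)}"

definition partitions_D :: "(nat \<Rightarrow> oint) set" where
  "partitions_D = {lam \<in> overpartitions. \<forall>i\<ge>1. sz (lam i) > 0 \<longrightarrow> overlined (lam i)}"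

definition partitions_F :: "(nat \<Rightarrow> oint) set" where
  "partitions_F = {lam \<in> overpartitions. \<forall>k\<ge>1. Ov k \<le> lam 1 \<longrightarrow> (\<exists>i\<ge>1. lam i = Ov k)}"

section \<open>Statistics\<close>

definition nsmul :: "nat \<Rightarrow> 'a::comm_monoid_add \<Rightarrow> 'a" where
  "nsmul n a = (\<Sum>_<n. a)"

definition wsize :: "(nat \<Rightarrow> 'a::comm_monoid_add) \<Rightarrow> (nat \<Rightarrow> oint) \<Rightarrow> 'a" where
  "wsize s lam = (\<Sum>i \<in> {i. i \<ge> 1 \<and> lam i \<noteq> Pl 0}. nsmul (sz (lam i)) (s i))"

text \<open>Terms with $\lambda_{j+im} = 0$ vanish, so the sum may be restricted to a finite set.
  For an over-partition every term is non-negative (an over-lined part is strictly larger in size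
  than the next part), so the final \<open>nat\<close> loses nothing.\<close>

definition rho :: "nat \<Rightarrow> nat \<Rightarrow> (nat \<Rightarrow> oint) \<Rightarrow> nat" where
  "rho m j lam = nat (\<Sum>i \<in> {i. lam (j + i * m) \<noteq> Pl 0}.
      int (sz (lam (j + i * m))) - int (sz (lam (j + 1 + i * m)))
        - (if overlined (lam (j + i * m)) then 1 else 0))"

definition rho_over :: "nat \<Rightarrow> nat \<Rightarrow> (nat \<Rightarrow> oint) \<Rightarrow> nat" where
  "rho_over m j lam = card {i. overlined (lam (j + i * m))}"

section \<open>Formal series in the colors and in the formal powers of q\<close>

type_synonym 'a mono = "(oint \<Rightarrow>\<^sub>0 nat) \<times> 'a"

text \<open>A monomial is a color monomial (exponent vector) times $q^a$, $a \in \mathcal M$. Finite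
  combinations of monomials with integer coefficients form the monoid ring \<^typ>\<open>'a mono \<Rightarrow>\<^sub>0 int\<close>;
  arbitrary formal sums of monomials are functions \<^typ>\<open>'a mono \<Rightarrow> int\<close>, with \<open>lookup\<close> as
  inclusion. The latter carry the product topology of the discrete topology: limits and
  infinite sums are coefficientwise, each coefficient becoming eventually constant.\<close>

abbreviation lookup :: "('k \<Rightarrow>\<^sub>0 int) \<Rightarrow> 'k \<Rightarrow> int" where
  "lookup \<equiv> Poly_Mapping.lookup"

text \<open>This topology is Hausdorff, so both of the following are determined by their defining property
  whenever the limit, respectively the sum, exists. (The library's \<open>lim\<close> and \<open>infsum\<close> cannot be used
  because function types are not an instance of the class \<open>t2_space\<close>.)\<close>

definition series_lim :: "(nat \<Rightarrow> 'k \<Rightarrow> int) \<Rightarrow> 'k \<Rightarrow> int" where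
  "series_lim X = (THE f. X \<longlonglongrightarrow> f)"

definition series_sum :: "('i \<Rightarrow> 'k \<Rightarrow> int) \<Rightarrow> 'i set \<Rightarrow> 'k \<Rightarrow> int" where
  "series_sum X I = (THE f. (X has_sum f) I)"

definition col :: "oint \<Rightarrow> 'a::comm_monoid_add mono \<Rightarrow>\<^sub>0 int" where
  "col x = Poly_Mapping.single (Poly_Mapping.single x 1, 0) 1"

definition qpow :: "'a \<Rightarrow> 'a::comm_monoid_add mono \<Rightarrow>\<^sub>0 int" where
  "qpow a = Poly_Mapping.single (0, a) 1"

text \<open>For general $\mathcal M$ an infinite sum of monomials may fail to exist, because a monomial may
  occur infinitely often. For instance, with \<open>m = 1\<close> and $s_i = 0$ the partitions $(1^k)$, $k \ge 1$, all
  contribute the same monomial. Identities between such sums therefore presuppose summability.\<close>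

text \<open>Since $\mathcal M$ is arbitrary, the product of two formal sums need not exist; it does if each
  coefficient receives only finitely many contributions. Note that \<open>\<star>\<close> is the Cauchy product,
  whereas \<open>*\<close> on functions is pointwise and is not used.\<close>

definition contributions ::
    "('k::comm_monoid_add \<Rightarrow> int) \<Rightarrow> ('k \<Rightarrow> int) \<Rightarrow> 'k \<Rightarrow> ('k \<times> 'k) set" where
  "contributions f g z = {(x, y). x + y = z \<and> f x \<noteq> 0 \<and> g y \<noteq> 0}"

definition mult_defined :: "('k::comm_monoid_add \<Rightarrow> int) \<Rightarrow> ('k \<Rightarrow> int) \<Rightarrow> bool" where
  "mult_defined f g \<longleftrightarrow> (\<forall>z. finite (contributions f g z))"

definition series_mult ::
    "('k::comm_monoid_add \<Rightarrow> int) \<Rightarrow> ('k \<Rightarrow> int) \<Rightarrow> 'k \<Rightarrow> int"  (infixl \<open>\<star>\<close> 70) where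
  "f \<star> g = (\<lambda>z. \<Sum>(x, y) \<in> contributions f g z. f x * g y)"

text \<open>The quotient is unique whenever the part of \<open>g\<close> of color degree 0 is the monomial $1$
  (solve for the coefficients of \<open>h\<close> by induction on the color degree); this is the case for all
  denominators to which it is applied.\<close>

definition series_div ::
    "('k::comm_monoid_add \<Rightarrow> int) \<Rightarrow> ('k \<Rightarrow> int) \<Rightarrow> 'k \<Rightarrow> int"  (infixl \<open>\<oslash>\<close> 70) where
  "f \<oslash> g = (THE h. mult_defined h g \<and> h \<star> g = f)"

section \<open>q-Pochhammer symbols\<close>

text \<open>\<open>qpoch a s n\<close> is $(a;q^s)_n$ and \<open>qpochs [a\<^sub>1,\<dots>,a\<^sub>j] s n\<close> is $(a_1,\dots,a_j;q^s)_n$, for finite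
  \<open>n\<close>; the versions with suffix \<open>_inf\<close> are the case $n = \infty$.\<close>

definition qpoch ::
    "('a::comm_monoid_add mono \<Rightarrow>\<^sub>0 int) \<Rightarrow> 'a \<Rightarrow> nat \<Rightarrow> 'a mono \<Rightarrow>\<^sub>0 int" where
  "qpoch a s n = (\<Prod>k<n. 1 - a * qpow (nsmul k s))"

definition qpoch_inf ::
    "('a::comm_monoid_add mono \<Rightarrow>\<^sub>0 int) \<Rightarrow> 'a \<Rightarrow> 'a mono \<Rightarrow> int" where
  "qpoch_inf a s = series_lim (\<lambda>n. lookup (qpoch a s n))"

definition qpochs ::
    "('a::comm_monoid_add mono \<Rightarrow>\<^sub>0 int) list \<Rightarrow> 'a \<Rightarrow> nat \<Rightarrow> 'a mono \<Rightarrow>\<^sub>0 int" where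
  "qpochs as s n = (\<Prod>a\<leftarrow>as. qpoch a s n)"

definition qpochs_inf ::
    "('a::comm_monoid_add mono \<Rightarrow>\<^sub>0 int) list \<Rightarrow> 'a \<Rightarrow> 'a mono \<Rightarrow> int" where
  "qpochs_inf as s = foldr (\<lambda>a f. qpoch_inf a s \<star> f) as (lookup 1)"

end

theory Submission
  imports Defs "HOL-Library.Multiset"
begin

text \<open>An over-partition is determined by two data read off its conjugate: the multiset \<open>A\<close> containing
  \<open>k\<close> with multiplicity $\lambda_k - \lambda_{k+1} - \chi(\lambda_k \text{ is over-lined})$, and the finite set
  \<open>B\<close> of the \<open>k\<close> with $\lambda_k$ over-lined; both may be prescribed arbitrarily. By partial summation
  $|\lambda|_S$ is the sum of $S_k$ over \<open>A\<close> and \<open>B\<close>, and since $S_{j+im} = S_j + i S_m$, every element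
  $k = j + im$ contributes a factor $c_j q^{S_j + i S_m}$ or $c_{\overline j} q^{S_j + i S_m}$ to the weight
  of $\lambda$. The sets $\mathcal P$ and $\overline{\mathcal F}$ are the cases \<open>B = {}\<close> and \<open>A = {#}\<close>, which
  yields products over all $(j, i)$; in $\overline{\mathcal D}$ the set \<open>B\<close> is an initial segment
  \<open>{1..L}\<close> containing all elements of \<open>A\<close>, and $L = nm + \ell - 1$ yields the last sum.\<close>

section \<open>Generating functions of weighted index sets\<close>

text \<open>An arbitrary commutative monoid has neither a grading nor cancellation, so the infinite
  sums, Cauchy products and quotients on the right do not exist by themselves. The only resource is
  the summability assumed on the left. All terms there are monomials with coefficient 1 and cannot
  cancel, so summability says exactly that each monomial occurs finitely often. This finiteness
  depends on the indices alone and passes to subfamilies. Numerator and denominator are indexed by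
  such subfamilies (the sets \<open>B\<close>, and sets \<open>C\<close> viewed as multisets without
  repetition), so they inherit it although the denominator has signs. Reciprocals then amount to a
  sign cancellation between multisets and sets, and the quotient is pinned down by the total degree
  in the colors, the one grading that is always present.\<close>

definition finite_fibres :: "('i \<Rightarrow> 'k) \<Rightarrow> 'i set \<Rightarrow> bool" where
  "finite_fibres w I \<longleftrightarrow> (\<forall>z. finite {i \<in> I. w i = z})"

text \<open>On an infinite fibre the sum defaults to 0, so \<open>gf\<close> is the intended formal
  sum only together with \<open>finite_fibres\<close>.\<close>

definition gf :: "('i \<Rightarrow> int) \<Rightarrow> ('i \<Rightarrow> 'k) \<Rightarrow> 'i set \<Rightarrow> 'k \<Rightarrow> int" where
  "gf c w I z = (\<Sum>i \<in> {i \<in> I. w i = z}. c i)"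

lemma finite_fibresD: "finite_fibres w I \<Longrightarrow> finite {i \<in> I. w i = z}"
  by (simp add: finite_fibres_def)

lemma finite_fibres_subset: "finite_fibres w J \<Longrightarrow> I \<subseteq> J \<Longrightarrow> finite_fibres w I"
  unfolding finite_fibres_def
  by (intro allI, rule finite_subset[of _ "{i \<in> J. w i = z}" for z]) auto

lemma finite_fibres_bij_betw:
  assumes "bij_betw h J I"
  shows "finite_fibres (\<lambda>j. w (h j)) J \<longleftrightarrow> finite_fibres w I"
proof -
  have "bij_betw h {j \<in> J. w (h j) = z} {i \<in> I. w i = z}" for z
    using assms by (auto simp: bij_betw_def inj_on_def)
  then show ?thesis
    unfolding finite_fibres_def using bij_betw_finite by blast
qed

lemma gf_bij_betw:
  assumes "bij_betw h J I"
  shows "gf (\<lambda>j. c (h j)) (\<lambda>j. w (h j)) J = gf c w I"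
proof
  fix z
  have "bij_betw h {j \<in> J. w (h j) = z} {i \<in> I. w i = z}"
    using assms by (auto simp: bij_betw_def inj_on_def)
  then show "gf (\<lambda>j. c (h j)) (\<lambda>j. w (h j)) J z = gf c w I z"
    unfolding gf_def by (rule sum.reindex_bij_betw)
qed

lemma gf_cong:
  assumes "\<And>i. i \<in> I \<Longrightarrow> c i = c' i" "\<And>i. i \<in> I \<Longrightarrow> w i = w' i"
  shows "gf c w I = gf c' w' I"
  unfolding gf_def fun_eq_iff using assms by (auto intro!: sum.cong)

lemma gf_nonzeroE:
  assumes "gf c w I z \<noteq> 0"
  obtains i where "i \<in> I" "w i = z"
  using assms unfolding gf_def by (metis (mono_tags, lifting) mem_Collect_eq sum.not_neutral_contains_not_neutral)

lemma lookup_sum_single: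
  assumes "finite I"
  shows "lookup (\<Sum>i\<in>I. Poly_Mapping.single (w i) (c i)) = gf c w I"
proof
  fix z
  have "lookup (\<Sum>i\<in>I. Poly_Mapping.single (w i) (c i)) z = (\<Sum>i\<in>I. if w i = z then c i else 0)"
    by (simp add: lookup_sum lookup_single when_def)
  also have "\<dots> = gf c w I z"
    unfolding gf_def using assms by (simp add: sum.inter_filter)
  finally show "lookup (\<Sum>i\<in>I. Poly_Mapping.single (w i) (c i)) z = gf c w I z" .
qed

text \<open>Every contributing pair of exponents comes from a pair of indices in \<open>P z\<close>,
  so finiteness of that one set gives both the existence of the product and the freedom to regroup.
  Grouping \<open>P z\<close> by the pair of weights splits each group into a product of two
  fibres.\<close>

lemma gf_mult:
  fixes w :: "'i \<Rightarrow> 'k::comm_monoid_add"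
  assumes fin: "finite_fibres (\<lambda>(i, j). w i + v j) (I \<times> J)"
  shows "mult_defined (gf c w I) (gf d v J)" (is ?A)
    and "gf c w I \<star> gf d v J = gf (\<lambda>(i, j). c i * d j) (\<lambda>(i, j). w i + v j) (I \<times> J)" (is ?B)
proof -
  define P where "P z = {(i, j) \<in> I \<times> J. w i + v j = z}" for z
  have finP: "finite (P z)" for z
    using finite_fibresD[OF fin, of z] by (simp add: P_def case_prod_unfold mem_Times_iff conj_assoc)
  have sub: "contributions (gf c w I) (gf d v J) z \<subseteq> map_prod w v ` P z" for z
  proof
    fix p assume "p \<in> contributions (gf c w I) (gf d v J) z"
    then obtain x y where p: "p = (x, y)" "x + y = z" "gf c w I x \<noteq> 0" "gf d v J y \<noteq> 0"
      by (auto simp: contributions_def)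
    obtain i where "i \<in> I" "w i = x" using p(3) by (rule gf_nonzeroE)
    moreover obtain j where "j \<in> J" "v j = y" using p(4) by (rule gf_nonzeroE)
    ultimately show "p \<in> map_prod w v ` P z"
      using p by (force simp: P_def)
  qed
  show ?A
    unfolding mult_defined_def using sub finP by (meson finite_imageI finite_subset)
  show ?B
  proof
    fix z
    have fib: "gf c w I x * gf d v J y = (\<Sum>(i, j) \<in> {p \<in> P z. map_prod w v p = (x, y)}. c i * d j)"
      if "x + y = z" for x y
    proof -
      have "{p \<in> P z. map_prod w v p = (x, y)} = {i \<in> I. w i = x} \<times> {j \<in> J. v j = y}"
        using that by (auto simp: P_def)
      then show ?thesis
        by (simp add: gf_def sum_product sum.cartesian_product)
    qed
    have "(gf c w I \<star> gf d v J) z = (\<Sum>(x, y) \<in> map_prod w v ` P z. gf c w I x * gf d v J y)"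
      unfolding series_mult_def
    proof (rule sum.mono_neutral_left)
      show "\<forall>p\<in>map_prod w v ` P z - contributions (gf c w I) (gf d v J) z.
          (case p of (x, y) \<Rightarrow> gf c w I x * gf d v J y) = 0"
        by (auto simp: contributions_def P_def)
    qed (use finP sub in auto)
    also have "\<dots> = (\<Sum>q \<in> map_prod w v ` P z. \<Sum>(i, j) \<in> {p \<in> P z. map_prod w v p = q}. c i * d j)"
      by (rule sum.cong) (auto simp: P_def fib)
    also have "\<dots> = (\<Sum>(i, j) \<in> P z. c i * d j)"
      using finP by (rule sum.image_gen[symmetric])
    finally show "(gf c w I \<star> gf d v J) z = gf (\<lambda>(i, j). c i * d j) (\<lambda>(i, j). w i + v j) (I \<times> J) z"
      by (simp add: gf_def P_def case_prod_unfold mem_Times_iff conj_assoc)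
  qed
qed

section \<open>Coefficientwise limits, infinite sums and uniqueness of quotients\<close>

lemma sum_fun_apply: "(\<Sum>i\<in>F. f i) z = (\<Sum>i\<in>F. f i z :: int)"
  by (induction F rule: infinite_finite_induct) auto

lemma tendsto_fun_discrete_iff:
  fixes f :: "'i \<Rightarrow> 'k \<Rightarrow> int"
  shows "(f \<longlongrightarrow> l) F \<longleftrightarrow> (\<forall>z. eventually (\<lambda>i. f i z = l z) F)"
proof -
  have "(f \<longlongrightarrow> l) F \<longleftrightarrow> limitin (product_topology (\<lambda>_. euclidean) UNIV) f l F"
    by (simp add: euclidean_product_topology)
  also have "\<dots> \<longleftrightarrow> (\<forall>z. ((\<lambda>i. f i z) \<longlongrightarrow> l z) F)"
    by (simp add: limitin_componentwise)
  finally show ?thesis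
    by (simp add: tendsto_discrete)
qed

lemma series_lim_eqI:
  assumes "X \<longlonglongrightarrow> f"
  shows "series_lim X = f"
  unfolding series_lim_def
proof (rule the_equality)
  fix g assume g: "X \<longlonglongrightarrow> g"
  show "g = f"
  proof
    fix z
    have "\<forall>\<^sub>F n in sequentially. X n z = f z \<and> X n z = g z"
      using g assms by (simp add: tendsto_fun_discrete_iff eventually_conj)
    then show "g z = f z"
      by (auto dest: eventually_happens)
  qed
qed fact

lemma has_sum_fun_iff:
  fixes X :: "'i \<Rightarrow> 'k \<Rightarrow> int"
  shows "(X has_sum f) I \<longleftrightarrow> (\<forall>z. ((\<lambda>i. X i z) has_sum f z) I)"
  by (simp add: has_sum_def tendsto_fun_discrete_iff tendsto_discrete sum_fun_apply)

lemma series_sum_eqI: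
  assumes "(X has_sum f) I"
  shows "series_sum X I = f"
  unfolding series_sum_def
  using assms by (intro the_equality ext) (auto simp: has_sum_fun_iff intro: has_sum_unique)

text \<open>A convergent net of integers is eventually constant: once the finite set
  \<open>F\<close> is reached, adjoining one further index leaves the sum unchanged, so its term is
  0.\<close>

lemma summable_on_discreteD:
  fixes g :: "'i \<Rightarrow> int"
  assumes "g summable_on I"
  shows "finite {i \<in> I. g i \<noteq> 0}"
proof -
  obtain l where "(g has_sum l) I"
    using assms by (auto simp: summable_on_def)
  then obtain F where F: "finite F" "F \<subseteq> I"
      "\<And>G. finite G \<Longrightarrow> F \<subseteq> G \<Longrightarrow> G \<subseteq> I \<Longrightarrow> sum g G = l"
    unfolding has_sum_def tendsto_discrete eventually_finite_subsets_at_top by metis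
  have "g i = 0" if "i \<in> I" "i \<notin> F" for i
    using F(3)[of F] F(3)[of "insert i F"] F(1,2) that by auto
  then show ?thesis
    by (intro finite_subset[OF _ F(1)]) auto
qed

lemma has_sum_finite_support:
  fixes g :: "'i \<Rightarrow> int"
  assumes "finite F" "F \<subseteq> I" "\<And>i. i \<in> I - F \<Longrightarrow> g i = 0" "sum g F = l"
  shows "(g has_sum l) I"
proof -
  have "(g has_sum l) F"
    using assms by (simp add: has_sum_finiteI)
  then show ?thesis
    using assms has_sum_cong_neutral[of I F g g l] by auto
qed

lemma has_sum_gf:
  assumes "finite_fibres w I"
  shows "((\<lambda>i. lookup (Poly_Mapping.single (w i) 1)) has_sum gf (\<lambda>_. 1) w I) I"
  unfolding has_sum_fun_iff
  by (intro allI has_sum_finite_support[OF finite_fibresD[OF assms]])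
     (auto simp: gf_def lookup_single when_def)

text \<open>All coefficients are 1, so every index in a fibre contributes a nonzero term to that
  coefficient. This converse of \<open>has_sum_gf\<close> extracts all the finiteness used later
  from the summability hypotheses.\<close>

lemma summable_on_finite_fibres:
  assumes "(\<lambda>i. lookup (Poly_Mapping.single (w i) 1)) summable_on I"
  shows "finite_fibres w I"
  unfolding finite_fibres_def
proof
  fix z
  have "(\<lambda>i. lookup (Poly_Mapping.single (w i) 1) z) summable_on I"
    using assms unfolding summable_on_def has_sum_fun_iff by blast
  then have "finite {i \<in> I. lookup (Poly_Mapping.single (w i) (1::int)) z \<noteq> 0}"
    by (rule summable_on_discreteD)
  then show "finite {i \<in> I. w i = z}"
    by (rule finite_subset[rotated]) (auto simp: lookup_single)
qed

text \<open>Comparing coefficients by increasing degree works although \<open>x + y = z\<close> may have infinitely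
  many solutions \<open>x\<close> for fixed \<open>y\<close>, since only the term \<open>y = 0\<close> contains the coefficient at \<open>z\<close>.\<close>

lemma series_div_eqI:
  fixes deg :: "'k::comm_monoid_add \<Rightarrow> nat"
  assumes deg_add: "\<And>x y. deg (x + y) = deg x + deg y"
    and g0: "g 0 = 1" and g_pos: "\<And>y. g y \<noteq> 0 \<Longrightarrow> y \<noteq> 0 \<Longrightarrow> deg y > 0"
    and h: "mult_defined h g" "h \<star> g = f"
  shows "f \<oslash> g = h"
  unfolding series_div_def
proof (rule the_equality)
  fix h' assume h': "mult_defined h' g \<and> h' \<star> g = f"
  have split: "(k \<star> g) z = k z + (\<Sum>(x, y) \<in> {(x, y) \<in> contributions k g z. deg x < deg z}. k x * g y)"
    if k: "mult_defined k g" for k z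
  proof -
    let ?C = "contributions k g z"
    let ?L = "{(x, y) \<in> ?C. deg x < deg z}"
    have fin: "finite ?C" using k by (simp add: mult_defined_def)
    \<comment> \<open>Any other contributing \<open>y\<close> has positive degree and hence forces
      \<open>deg x < deg z\<close>. The case \<open>k z = 0\<close> is separate because
      \<open>contributions\<close> lists only nonzero coefficients.\<close>
    have "?C - ?L = (if k z = 0 then {} else {(z, 0)})"
    proof -
      have "(x, y) \<in> ?C - ?L \<longleftrightarrow> x = z \<and> y = 0 \<and> k z \<noteq> 0" for x y
      proof (cases "y = 0")
        case False
        then show ?thesis using g_pos[of y] by (auto simp: contributions_def deg_add)
      qed (auto simp: contributions_def g0)
      then show ?thesis by auto
    qed
    then have "(\<Sum>(x, y) \<in> ?C - ?L. k x * g y) = k z"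
      by (simp add: g0)
    then show ?thesis
      using sum.subset_diff[OF _ fin, of ?L "\<lambda>(x, y). k x * g y"] unfolding series_mult_def by auto
  qed
  show "h' = h"
  proof
    fix z show "h' z = h z"
    proof (induction "deg z" arbitrary: z rule: less_induct)
      case less
      \<comment> \<open>Both the index set and the summands involve \<open>h'\<close> and
        \<open>h\<close> only at degrees below \<open>deg z\<close>, where they agree by
        induction.\<close>
      have "(\<Sum>(x, y) \<in> {(x, y) \<in> contributions h' g z. deg x < deg z}. h' x * g y)
          = (\<Sum>(x, y) \<in> {(x, y) \<in> contributions h g z. deg x < deg z}. h x * g y)"
        by (rule sum.cong) (auto simp: contributions_def less)
      moreover have "(h' \<star> g) z = (h \<star> g) z"
        using h h' by simp
      ultimately show ?case
        using split[of h' z] split[of h z] h h' by simp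
    qed
  qed
qed (use h in auto)


text \<open>A fibre over the union is finite, hence by monotonicity contained in a single
  \<open>J N\<close>; from there on the coefficient is constant.\<close>

lemma gf_tendsto_UN:
  assumes "incseq J" "finite_fibres w (\<Union>n. J n)"
  shows "(\<lambda>n. gf c w (J n)) \<longlonglongrightarrow> gf c w (\<Union>n. J n)"
  unfolding tendsto_fun_discrete_iff
proof
  fix z
  let ?F = "{i \<in> \<Union>n. J n. w i = z}"
  have "finite ?F" using assms(2) by (rule finite_fibresD)
  moreover have "\<forall>i\<in>?F. \<exists>n. i \<in> J n" by auto
  then obtain f where f: "\<forall>i\<in>?F. i \<in> J (f i)"
    unfolding bchoice_iff by blast
  ultimately obtain N where "\<forall>n\<in>f ` ?F. n \<le> N"
    using finite_nat_set_iff_bounded_le[of "f ` ?F"] by blast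
  then have N: "?F \<subseteq> J N"
    using f incseqD[OF assms(1)] by blast
  have "{i \<in> J n. w i = z} = ?F" if "n \<ge> N" for n
    using N incseqD[OF assms(1) that] by auto
  then show "\<forall>\<^sub>F n in sequentially. gf c w (J n) z = gf c w (\<Union>n. J n) z"
    unfolding gf_def by (intro eventually_sequentiallyI[of N]) simp
qed

section \<open>Expanded products over sets and their reciprocals\<close>

lemma prod_single:
  fixes u :: "'n \<Rightarrow> 'k::comm_monoid_add"
  shows "(\<Prod>k\<in>C. Poly_Mapping.single (u k) e) = Poly_Mapping.single (sum u C) (e ^ card C :: int)"
  by (induction C rule: infinite_finite_induct) (auto simp: mult_single)

lemma lookup_prod_add_single:
  fixes u :: "'n \<Rightarrow> 'k::comm_monoid_add" and e :: int
  assumes "finite K"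
  shows "lookup (\<Prod>k\<in>K. 1 + Poly_Mapping.single (u k) e) = gf (\<lambda>C. e ^ card C) (sum u) (Pow K)"
proof -
  have "(\<Prod>k\<in>K. 1 + Poly_Mapping.single (u k) e)
      = (\<Sum>C\<in>Pow K. Poly_Mapping.single (sum u C) (e ^ card C))"
    using prod_add[OF assms, of "\<lambda>k. Poly_Mapping.single (u k) e" "\<lambda>_. 1"]
    by (simp add: prod_single add.commute)
  then show ?thesis
    using assms by (simp add: lookup_sum_single)
qed

text \<open>Expand the product of the factors \<open>- 1 + 1\<close> over \<open>S\<close>.\<close>

lemma sum_Pow_minus_one_power_card:
  assumes "finite S"
  shows "(\<Sum>C\<in>Pow S. (- 1) ^ card C) = (if S = {} then 1 else 0 :: int)"
  using prod_add[OF assms, of "\<lambda>_. - 1" "\<lambda>_. 1 :: int"] assms by (auto simp: power_0_left)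

lemma sum_mset_add_mset_set:
  "finite C \<Longrightarrow> (\<Sum>k\<in>#A + mset_set C. u k) = (\<Sum>k\<in>#A. u k) + sum u C"
  by (simp add: sum_unfold_sum_mset)

text \<open>Multisets over \<open>K\<close> against signed subsets of \<open>K\<close>: a fixed multiset union \<open>A + mset_set C\<close> arises
  from all subsets \<open>C\<close> of its support, and their signs cancel unless it is empty.\<close>

lemma gf_multisets_mult_signed_sets:
  fixes u :: "'n \<Rightarrow> 'k::comm_monoid_add" and v :: "'i \<Rightarrow> 'k"
    and K :: "'n set" and I :: "'i set" and d :: "'i \<Rightarrow> int"
  defines "h \<equiv> gf (\<lambda>(A, b). d b) (\<lambda>(A, b). (\<Sum>k\<in>#A. u k) + v b) ({A. set_mset A \<subseteq> K} \<times> I)"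
    and "g \<equiv> gf (\<lambda>C. (- 1) ^ card C) (sum u) (Fpow K)"
  assumes fin: "finite_fibres (\<lambda>(A, b). (\<Sum>k\<in>#A. u k) + v b) ({A. set_mset A \<subseteq> K} \<times> I)"
  shows "mult_defined h g" "h \<star> g = gf d v I"
proof -
  let ?w = "\<lambda>(A, b). (\<Sum>k\<in>#A. u k) + v b"
  \<comment> \<open>\<open>Q z\<close> indexes the terms of the Cauchy product; \<open>R z\<close>
    lists the same terms by the union \<open>T = A + mset_set C\<close> together with
    \<open>C\<close>, and \<open>r\<close> recovers \<open>A\<close> as the difference.\<close>
  define P where "P z = {(A, b) \<in> {A. set_mset A \<subseteq> K} \<times> I. (\<Sum>k\<in>#A. u k) + v b = z}" for z
  define Q where "Q z = {(p, C) \<in> ({A. set_mset A \<subseteq> K} \<times> I) \<times> Fpow K. ?w p + sum u C = z}" for z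
  define R where "R z = (SIGMA p:P z. Pow (set_mset (fst p)))" for z
  define r where "r = (\<lambda>((T, b :: 'i), C :: 'n set). ((T - mset_set C, b), C))"
  have finP: "finite (P z)" for z
    using finite_fibresD[OF fin, of z] by (simp add: P_def case_prod_unfold mem_Times_iff conj_assoc)
  \<comment> \<open>Each element of \<open>C\<close> has multiplicity 1 in \<open>mset_set C\<close>
    and at least 1 in \<open>T\<close>, so the subtraction in \<open>r\<close> loses
    nothing.\<close>
  have sub: "mset_set C \<subseteq># T" if "C \<subseteq> set_mset T" for C :: "'n set" and T
    using that finite_subset[OF that] by (auto simp: subseteq_mset_def count_mset_set' Suc_le_eq)
  have w_split: "(\<Sum>k\<in>#T. u k) = (\<Sum>k\<in>#T - mset_set C. u k) + sum u C" if "C \<subseteq> set_mset T" for T C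
    using sum_mset_add_mset_set[of C u "T - mset_set C"] sub[OF that] finite_subset[OF that] by simp
  have bij: "bij_betw r (R z) (Q z)" for z
  proof (rule bij_betwI[where g = "\<lambda>((A, b), C). ((A + mset_set C, b), C)"])
    show "r \<in> R z \<rightarrow> Q z"
    proof
      fix x assume "x \<in> R z"
      then obtain T b C where x: "x = ((T, b), C)" "set_mset T \<subseteq> K" "b \<in> I"
          "(\<Sum>k\<in>#T. u k) + v b = z" "C \<subseteq> set_mset T"
        by (auto simp: R_def P_def)
      have "set_mset (T - mset_set C) \<subseteq> K"
        using x(2) by (meson in_diffD subset_iff)
      moreover have "C \<in> Fpow K"
        using x(2,5) finite_subset[OF x(5)] by (auto simp: Fpow_def)
      moreover have "(\<Sum>k\<in>#T - mset_set C. u k) + v b + sum u C = z"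
        using x(4) w_split[OF x(5)] by (simp add: ac_simps)
      ultimately show "r x \<in> Q z"
        using x by (simp add: r_def Q_def)
    qed
    show "(\<lambda>((A, b), C). ((A + mset_set C, b), C)) \<in> Q z \<rightarrow> R z"
      by (auto simp: Q_def R_def P_def Fpow_def sum_mset_add_mset_set ac_simps simp del: image_mset_union)
    show "(\<lambda>((A, b), C). ((A + mset_set C, b), C)) (r x) = x" if "x \<in> R z" for x
      using that sub by (auto simp: r_def R_def)
    show "r ((\<lambda>((A, b), C). ((A + mset_set C, b), C)) y) = y" if "y \<in> Q z" for y
      by (auto simp: r_def split: prod.splits)
  qed
  \<comment> \<open>A multiset has only finitely many subsets of its support, so the finite fibres
    of \<open>h\<close> already make the product with \<open>g\<close> exist.\<close>
  have "finite (R z)" for z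
    unfolding R_def using finP by auto
  then have "finite (Q z)" for z
    using bij_betw_finite[OF bij] by blast
  then have finQ: "finite_fibres (\<lambda>(p, C). ?w p + sum u C) (({A. set_mset A \<subseteq> K} \<times> I) \<times> Fpow K)"
    by (simp add: finite_fibres_def Q_def case_prod_unfold mem_Times_iff conj_assoc)
  show "mult_defined h g"
    unfolding h_def g_def using finQ by (rule gf_mult)
  show "h \<star> g = gf d v I"
  proof
    fix z
    have "(h \<star> g) z = (\<Sum>(p, C) \<in> Q z. d (snd p) * (- 1) ^ card C)"
      unfolding h_def g_def gf_mult(2)[OF finQ] by (simp add: gf_def Q_def case_prod_unfold mem_Times_iff conj_assoc)
    also have "\<dots> = (\<Sum>(p, C) \<in> R z. d (snd p) * (- 1) ^ card C)"
      by (subst sum.reindex_bij_betw[OF bij, symmetric]) (auto simp: r_def intro!: sum.cong)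
    also have "\<dots> = (\<Sum>p\<in>P z. d (snd p) * (\<Sum>C\<in>Pow (set_mset (fst p)). (- 1) ^ card C))"
      unfolding R_def using finP by (subst sum.Sigma[symmetric]) (auto simp: sum_distrib_left)
    also have "\<dots> = (\<Sum>p\<in>P z. if fst p = {#} then d (snd p) else 0)"
      by (intro sum.cong) (auto simp: sum_Pow_minus_one_power_card)
    also have "\<dots> = (\<Sum>p\<in>{p \<in> P z. fst p = {#}}. d (snd p))"
      using finP by (simp add: sum.inter_filter)
    also have "\<dots> = gf d v I z"
      unfolding gf_def
      by (rule sum.reindex_bij_witness[where i = "\<lambda>b. ({#}, b)" and j = snd]) (auto simp: P_def)
    finally show "(h \<star> g) z = gf d v I z" .
  qed
qed

text \<open>Positive degree of every \<open>u k\<close> leaves the empty set as the only one of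
  degree 0. The denominator thus has constant term 1 and no other term of degree 0, which is what
  makes the quotient unique. Leaving \<open>I\<close> and \<open>v\<close> general covers infinite
  numerators as well as a single monomial.\<close>

lemma gf_div_signed_sets:
  fixes u :: "'n \<Rightarrow> 'k::comm_monoid_add" and v :: "'i \<Rightarrow> 'k" and deg :: "'k \<Rightarrow> nat"
  assumes deg_add: "\<And>x y. deg (x + y) = deg x + deg y"
    and deg_u: "\<And>k. k \<in> K \<Longrightarrow> deg (u k) > 0"
    and fin: "finite_fibres (\<lambda>(A, b). (\<Sum>k\<in>#A. u k) + v b) ({A. set_mset A \<subseteq> K} \<times> I)"
  shows "gf d v I \<oslash> gf (\<lambda>C. (- 1) ^ card C) (sum u) (Fpow K)
    = gf (\<lambda>(A, b). d b) (\<lambda>(A, b). (\<Sum>k\<in>#A. u k) + v b) ({A. set_mset A \<subseteq> K} \<times> I)"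
proof (rule series_div_eqI[of deg])
  have deg0: "deg 0 = 0"
    using deg_add[of 0 0] by simp
  have deg_sum: "deg (sum u C) = (\<Sum>k\<in>C. deg (u k))" for C
    by (induction C rule: infinite_finite_induct) (auto simp: deg0 deg_add)
  have pos: "deg (sum u C) > 0" if "C \<in> Fpow K" "C \<noteq> {}" for C
    using that deg_u unfolding deg_sum Fpow_def by (intro sum_pos; blast)
  have "{C \<in> Fpow K. sum u C = 0} = {{}}"
    using pos deg0 empty_in_Fpow by fastforce
  then show "gf (\<lambda>C. (- 1) ^ card C) (sum u) (Fpow K) 0 = 1"
    by (simp add: gf_def)
  show "deg y > 0" if "gf (\<lambda>C. (- 1) ^ card C) (sum u) (Fpow K) y \<noteq> 0" "y \<noteq> 0" for y
    using that(1)
  proof (rule gf_nonzeroE)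
    fix C assume "C \<in> Fpow K" "sum u C = y"
    then show "deg y > 0" using pos that(2) by fastforce
  qed
qed (fact deg_add gf_multisets_mult_signed_sets[OF fin])+

section \<open>Conjugation of over-partitions\<close>

text \<open>This is the \<open>k\<close>-th part of the partition conjugate to
  \<open>T\<close>.\<close>

definition tail :: "nat multiset \<Rightarrow> nat \<Rightarrow> nat" where
  "tail T k = size {#i \<in># T. k \<le> i#}"

lemma tail_Suc: "tail T k = count T k + tail T (Suc k)"
  unfolding tail_def by (induction T) auto

lemma tail_antimono: "i \<le> j \<Longrightarrow> tail T j \<le> tail T i"
  unfolding tail_def by (induction T) auto

lemma tail_pos_iff: "tail T k > 0 \<longleftrightarrow> (\<exists>i\<in>#T. k \<le> i)"
  unfolding tail_def by (induction T) auto

lemma tail_add_mset: "tail (add_mset i T) k = tail T k + (if k \<le> i then 1 else 0)"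
  by (simp add: tail_def)

text \<open>An element of \<open>B\<close> both over-lines its part and is counted in the conjugate.
  The latter forces a drop in size right after the over-lined part, so that this part is not
  repeated.\<close>

definition of_conjugate :: "nat multiset \<times> nat set \<Rightarrow> nat \<Rightarrow> oint" where
  "of_conjugate = (\<lambda>(A, B) k. if k = 0 then Pl 0
     else (if k \<in> B then Ov else Pl) (tail (A + mset_set B) k))"

definition conjugates :: "(nat multiset \<times> nat set) set" where
  "conjugates = {A. set_mset A \<subseteq> {1..}} \<times> Fpow {1..}"

lemma conjugatesD:
  assumes "(A, B) \<in> conjugates"
  shows "set_mset A \<subseteq> {1..}" "finite B" "B \<subseteq> {1..}" "set_mset (A + mset_set B) = set_mset A \<union> B"
  using assms by (auto simp: conjugates_def Fpow_def)

lemma overlined_of_conjugate: "overlined (of_conjugate (A, B) k) \<longleftrightarrow> k \<noteq> 0 \<and> k \<in> B"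
  by (simp add: of_conjugate_def)

lemma sz_of_conjugate: "k \<noteq> 0 \<Longrightarrow> sz (of_conjugate (A, B) k) = tail (A + mset_set B) k"
  by (simp add: of_conjugate_def)

lemma of_conjugate_eq_Ov_iff:
  "of_conjugate (A, B) k = Ov n \<longleftrightarrow> k \<noteq> 0 \<and> k \<in> B \<and> tail (A + mset_set B) k = n"
  by (auto simp: of_conjugate_def)

lemma tail_Suc_less:
  assumes "k \<in># T"
  shows "tail T (Suc k) < tail T k"
  using assms by (simp add: tail_Suc[of T k])

lemma oint_eqI: "sz x = sz y \<Longrightarrow> overlined x = overlined y \<Longrightarrow> x = y"
  by (cases x; cases y) auto

text \<open>The tail drops strictly after each element of \<open>T\<close>. This is why distinct
  over-lined positions carry distinct sizes.\<close>

lemma tail_inj_on: "inj_on (tail T) (set_mset T)"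
proof (rule linorder_inj_onI)
  fix x y assume "x < y" "x \<in># T"
  then show "tail T x \<noteq> tail T y"
    using tail_antimono[of "Suc x" y T] tail_Suc_less[of x T] by simp
qed auto

text \<open>After an element of the conjugate the size drops strictly. Elsewhere it stays and the
  current part is plain, so the next part is either the same or its over-lined copy, which is
  smaller in the order.\<close>

lemma of_conjugate_overpartition:
  assumes AB: "(A, B) \<in> conjugates"
  shows "of_conjugate (A, B) \<in> overpartitions"
proof -
  let ?T = "A + mset_set B" and ?l = "of_conjugate (A, B)"
  note sub = conjugatesD[OF AB]
  have "?l i \<noteq> Ov 0" if "i \<ge> 1" for i
    using sub(4) tail_Suc_less[of i ?T] by (auto simp: of_conjugate_eq_Ov_iff)
  moreover have "?l (i + 1) \<le> ?l i" if "i \<ge> 1" for i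
  proof (cases "i \<in># ?T")
    case True
    then show ?thesis
      using that tail_Suc_less[of i ?T] by (simp add: less_eq_oint_def less_oint_def sz_of_conjugate)
  next
    case False
    then have "tail ?T (Suc i) = tail ?T i" "i \<notin> B"
      using sub(4) by (auto simp: tail_Suc[of ?T i] count_eq_zero_iff)
    moreover have "?l (i + 1) = ?l i" if "\<not> overlined (?l (i + 1))"
      using \<open>i \<ge> 1\<close> that calculation
      by (intro oint_eqI) (simp_all add: sz_of_conjugate overlined_of_conjugate)
    ultimately show ?thesis
      using that by (auto simp: less_eq_oint_def less_oint_def sz_of_conjugate overlined_of_conjugate)
  qed
  moreover have "finite {i. i \<ge> 1 \<and> ?l i \<noteq> Pl 0}"
  proof (rule finite_subset)
    show "{i. i \<ge> 1 \<and> ?l i \<noteq> Pl 0} \<subseteq> (\<Union>j\<in>set_mset ?T. {..j})"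
    proof
      fix i assume i: "i \<in> {i. i \<ge> 1 \<and> ?l i \<noteq> Pl 0}"
      then have "tail ?T i > 0 \<or> i \<in> B"
        by (auto simp: of_conjugate_def split: if_splits)
      then have "\<exists>j\<in>#?T. i \<le> j"
        using sub(4) by (auto simp: tail_pos_iff)
      then show "i \<in> (\<Union>j\<in>set_mset ?T. {..j})" by auto
    qed
  qed auto
  moreover have "i = j" if "?l i = ?l j" "overlined (?l i)" "i \<ge> 1" "j \<ge> 1" for i j
  proof -
    have "overlined (?l j)" using that by simp
    then have "i \<in> B" "j \<in> B"
      using that(2) by (simp_all only: overlined_of_conjugate)
    then have "i \<in># ?T" "j \<in># ?T"
      unfolding sub(4) by simp_all
    moreover have "tail ?T i = tail ?T j"
      using arg_cong[OF that(1), of sz] that(3,4) by (simp add: sz_of_conjugate)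
    ultimately show ?thesis
      using tail_inj_on[of ?T] by (simp add: inj_on_def)
  qed
  moreover have "?l 0 = Pl 0"
    by (simp add: of_conjugate_def)
  ultimately show ?thesis
    unfolding overpartitions_def by blast
qed

definition plain_steps :: "(nat \<Rightarrow> oint) \<Rightarrow> nat multiset" where
  "plain_steps lam = (\<Sum>k | k \<ge> 1 \<and> lam k \<noteq> Pl 0.
     replicate_mset (sz (lam k) - sz (lam (Suc k)) - (if overlined (lam k) then 1 else 0)) k)"

definition overlined_positions :: "(nat \<Rightarrow> oint) \<Rightarrow> nat set" where
  "overlined_positions lam = {k. k \<ge> 1 \<and> overlined (lam k)}"

lemma count_plain_steps:
  assumes "lam \<in> overpartitions" "k \<ge> 1"
  shows "count (plain_steps lam) k
    = sz (lam k) - sz (lam (Suc k)) - (if overlined (lam k) then 1 else 0)"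
proof -
  have "finite {k. k \<ge> 1 \<and> lam k \<noteq> Pl 0}"
    using assms(1) by (simp add: overpartitions_def)
  then show ?thesis
    using assms(2) by (auto simp: plain_steps_def count_sum)
qed

text \<open>An over-lined part cannot be repeated, and its plain copy is larger, so the next part
  has smaller size. Hence the truncated subtractions in \<open>plain_steps\<close> are
  exact.\<close>

lemma overpartition_steps:
  assumes "lam \<in> overpartitions" "k \<ge> 1"
  shows "sz (lam (Suc k)) + (if overlined (lam k) then 1 else 0) \<le> sz (lam k)"
proof -
  have *: "\<forall>i\<ge>1. \<forall>j\<ge>1. lam i = lam j \<and> overlined (lam i) \<longrightarrow> i = j" and **: "\<forall>i\<ge>1. lam (i + 1) \<le> lam i"
    using assms(1) unfolding overpartitions_def by blast+
  have "lam (Suc k) \<le> lam k"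
    using ** assms(2) by simp
  moreover have "\<not> (lam k = lam (Suc k) \<and> overlined (lam k))"
    using *[rule_format, of k "Suc k"] assms(2) by auto
  ultimately show ?thesis
    by (auto simp: less_eq_oint_def less_oint_def)
qed

lemma conjugate_in_conjugates:
  assumes "lam \<in> overpartitions"
  shows "(plain_steps lam, overlined_positions lam) \<in> conjugates"
proof -
  have fin: "finite {k. k \<ge> 1 \<and> lam k \<noteq> Pl 0}"
    using assms by (simp add: overpartitions_def)
  then have "set_mset (plain_steps lam) \<subseteq> {1..}"
    by (auto simp: plain_steps_def set_mset_sum split: if_splits)
  moreover have "finite (overlined_positions lam)"
    by (rule finite_subset[OF _ fin]) (auto simp: overlined_positions_def)
  ultimately show ?thesis
    by (auto simp: conjugates_def Fpow_def overlined_positions_def)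
qed

lemma of_conjugate_conjugate:
  assumes lam: "lam \<in> overpartitions"
  shows "of_conjugate (plain_steps lam, overlined_positions lam) = lam"
proof
  fix k
  let ?T = "plain_steps lam + mset_set (overlined_positions lam)"
  note AB = conjugate_in_conjugates[OF lam]
  have fin: "finite {k. k \<ge> 1 \<and> lam k \<noteq> Pl 0}"
    using lam by (simp add: overpartitions_def)
  then obtain N where "\<forall>k\<in>{k. k \<ge> 1 \<and> lam k \<noteq> Pl 0}. k < N"
    unfolding finite_nat_set_iff_bounded by blast
  then have N: "lam k = Pl 0" if "k \<ge> 1" "k \<ge> N" for k
    using that by force
  \<comment> \<open>The multiplicity in \<open>plain_steps\<close> omits 1 at an over-lined part,
    and \<open>overlined_positions\<close> restores it.\<close>
  have count: "count ?T k = sz (lam k) - sz (lam (Suc k))" if "k \<ge> 1" for k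
    using that overpartition_steps[OF lam that] conjugatesD(2)[OF AB]
    by (auto simp: count_plain_steps[OF lam] count_mset_set' overlined_positions_def split: if_splits)
  have tail_N: "tail ?T k = 0" if "k \<ge> 1" "k \<ge> N" for k
  proof -
    have "count ?T i = 0" if "i \<ge> k" for i
      using count[of i] N[of i] \<open>k \<ge> 1\<close> \<open>k \<ge> N\<close> that by simp
    then have "\<not> (\<exists>i\<in>#?T. k \<le> i)"
      by (metis not_in_iff)
    then show ?thesis
      using tail_pos_iff[of ?T k] by simp
  qed
  \<comment> \<open>Downward induction from \<open>N\<close>, beyond all nonzero parts, where both
    sides vanish: the differences telescope.\<close>
  have tail: "tail ?T k = sz (lam k)" if "k \<ge> 1" for k
  proof (cases "k \<le> N")
    case True
    then show ?thesis using that
    proof (induction rule: inc_induct)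
      case base
      then show ?case using tail_N[of N] N[of N] by simp
    next
      case (step n)
      then show ?case
        using overpartition_steps[OF lam, of n] unfolding tail_Suc[of ?T n] by (subst count) auto
    qed
  qed (use that tail_N N in simp)
  show "of_conjugate (plain_steps lam, overlined_positions lam) k = lam k"
  proof (cases "k = 0")
    case True
    then show ?thesis using lam by (simp add: of_conjugate_def overpartitions_def)
  next
    case False
    then show ?thesis
      using tail[of k]
      by (intro oint_eqI) (auto simp: sz_of_conjugate overlined_of_conjugate overlined_positions_def)
  qed
qed

lemma count_of_conjugate:
  assumes "(A, B) \<in> conjugates" "k \<ge> 1"
  shows "sz (of_conjugate (A, B) k)
    = count A k + sz (of_conjugate (A, B) (Suc k)) + (if overlined (of_conjugate (A, B) k) then 1 else 0)"
  using assms(2) conjugatesD(2)[OF assms(1)]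
  by (simp add: sz_of_conjugate overlined_of_conjugate tail_Suc[of _ k] count_mset_set')

lemma bij_betw_of_conjugate: "bij_betw of_conjugate conjugates overpartitions"
proof (rule bij_betwI[where g = "\<lambda>lam. (plain_steps lam, overlined_positions lam)"])
  show "(plain_steps (of_conjugate x), overlined_positions (of_conjugate x)) = x"
    if "x \<in> conjugates" for x
  proof -
    obtain A B where x: "x = (A, B)" by fastforce
    note AB = that[unfolded x]
    have "count (plain_steps (of_conjugate (A, B))) k = count A k" for k
    \<comment> \<open>The formula for the multiplicities holds for positive positions only; 0 is
      excluded on both sides by membership in \<open>conjugates\<close>.\<close>
    proof (cases "k = 0")
      case True
      have "0 \<notin># A" "0 \<notin># plain_steps (of_conjugate (A, B))"
        using conjugatesD(1)[OF AB]
          conjugatesD(1)[OF conjugate_in_conjugates[OF of_conjugate_overpartition[OF AB]]] by auto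
      then show ?thesis
        by (simp add: True not_in_iff)
    next
      case False
      then show ?thesis
        using count_of_conjugate[OF AB, of k]
        by (simp add: count_plain_steps[OF of_conjugate_overpartition[OF AB]])
    qed
    moreover have "overlined_positions (of_conjugate (A, B)) = B"
      using conjugatesD(3)[OF AB] by (auto simp: overlined_positions_def overlined_of_conjugate)
    ultimately show ?thesis
      by (simp add: x multiset_eq_iff)
  qed
qed (auto simp: of_conjugate_overpartition conjugate_in_conjugates of_conjugate_conjugate)

section \<open>Conjugates of the three subclasses\<close>

lemma bij_betw_restrict:
  assumes "bij_betw f X Y" "\<And>x. x \<in> X \<Longrightarrow> Q x \<longleftrightarrow> R (f x)"
  shows "bij_betw f {x \<in> X. Q x} {y \<in> Y. R y}"
  using assms by (auto simp: bij_betw_def inj_on_def)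

lemma bij_betw_partitions_P:
  "bij_betw (\<lambda>A. of_conjugate (A, {})) {A. set_mset A \<subseteq> {1..}} partitions_P"
proof -
  have "bij_betw of_conjugate {x \<in> conjugates. snd x = {}} partitions_P"
    unfolding partitions_P_def
  proof (rule bij_betw_restrict[OF bij_betw_of_conjugate])
    fix x assume "x \<in> conjugates"
    then show "snd x = {} \<longleftrightarrow> (\<forall>i\<ge>1. \<not> overlined (of_conjugate x i))"
      by (cases x) (auto simp: overlined_of_conjugate conjugates_def Fpow_def)
  qed
  moreover have "bij_betw (\<lambda>A. (A, {})) {A. set_mset A \<subseteq> {1..}} {x \<in> conjugates. snd x = {}}"
    by (auto simp: bij_betw_def inj_on_def conjugates_def Fpow_def)
  ultimately have "bij_betw (of_conjugate \<circ> (\<lambda>A. (A, {}))) {A. set_mset A \<subseteq> {1..}} partitions_P"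
    by (rule bij_betw_trans[rotated])
  then show ?thesis
    by (simp add: comp_def)
qed

text \<open>If \<open>A\<close> is empty, the sizes fall in steps of at most 1 and only after
  over-lined parts, so no size can be skipped. An element of \<open>A\<close> instead produces a
  drop with no over-lined part of the size just above the lower end of that drop.\<close>

lemma bij_betw_partitions_F:
  "bij_betw (\<lambda>B. of_conjugate ({#}, B)) (Fpow {1..}) partitions_F"
proof -
  have "bij_betw of_conjugate {x \<in> conjugates. fst x = {#}} partitions_F"
    unfolding partitions_F_def
  proof (rule bij_betw_restrict[OF bij_betw_of_conjugate])
    fix x assume "x \<in> conjugates"
    then obtain A B where x: "x = (A, B)" and AB: "(A, B) \<in> conjugates" by (cases x) auto
    let ?l = "of_conjugate (A, B)" and ?T = "A + mset_set B"
    note sub = conjugatesD[OF AB]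
    \<comment> \<open>\<open>Ov k\<close> is the least element of size \<open>k\<close>, so only
      sizes matter in the comparison.\<close>
    have le: "Ov k \<le> ?l 1 \<longleftrightarrow> k \<le> tail ?T 1" for k
      using sz_of_conjugate[of 1 A B] by (cases "?l 1") (auto simp: less_eq_oint_def less_oint_def)
    have "A = {#} \<longleftrightarrow> (\<forall>k\<ge>1. Ov k \<le> ?l 1 \<longrightarrow> (\<exists>i\<ge>1. ?l i = Ov k))"
    proof (intro iffI allI impI)
      fix k :: nat assume A: "A = {#}" and k: "1 \<le> k" "Ov k \<le> ?l 1"
      \<comment> \<open>The last position with size at least \<open>k\<close>: the drop right after
        it is at most 1, so the size there is exactly \<open>k\<close> and the part is
        over-lined.\<close>
      define i where "i = (GREATEST i. k \<le> tail ?T i)"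
      have bound: "i \<le> Max (set_mset ?T)" if "k \<le> tail ?T i" for i
      proof -
        have "tail ?T i > 0" using that k(1) by simp
        then obtain j where "j \<in># ?T" "i \<le> j" by (auto simp: tail_pos_iff)
        then show ?thesis by (meson Max_ge finite_set_mset le_trans)
      qed
      have i: "k \<le> tail ?T i"
        unfolding i_def using k(2)[unfolded le] bound by (rule GreatestI_nat)
      have "1 \<le> i"
        unfolding i_def using k(2)[unfolded le] bound by (rule Greatest_le_nat)
      have "\<not> k \<le> tail ?T (Suc i)"
        using Greatest_le_nat[of "\<lambda>i. k \<le> tail ?T i" "Suc i", OF _ bound] unfolding i_def[symmetric] by auto
      moreover have "tail ?T i = (if i \<in> B then 1 else 0) + tail ?T (Suc i)"
        using sub(2) A by (simp add: tail_Suc[of _ i] count_mset_set')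
      ultimately have "i \<in> B" "tail ?T i = k"
        using i by (auto split: if_splits)
      then show "\<exists>i\<ge>1. ?l i = Ov k"
        using \<open>1 \<le> i\<close> by (intro exI[of _ i]) (simp add: of_conjugate_eq_Ov_iff)
    next
      assume *: "\<forall>k\<ge>1. Ov k \<le> ?l 1 \<longrightarrow> (\<exists>i\<ge>1. ?l i = Ov k)"
      show "A = {#}"
      proof (rule ccontr)
        assume "A \<noteq> {#}"
        then obtain i where i: "i \<in># A" by blast
        then have "i \<in># ?T" "i \<ge> 1" using sub(1) by auto
        have "Suc (tail ?T (Suc i)) \<le> tail ?T i"
          using tail_Suc_less[OF \<open>i \<in># ?T\<close>] by simp
        also have "\<dots> \<le> tail ?T 1"
          using \<open>i \<ge> 1\<close> by (rule tail_antimono)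
        \<comment> \<open>The value tested is one more than the size just after position
          \<open>i\<close>.\<close>
        finally obtain j where "?l j = Ov (Suc (tail ?T (Suc i)))"
          using * unfolding le by force
        then have j: "j \<in> B" "tail ?T j = Suc (tail ?T (Suc i))"
          by (auto simp: of_conjugate_eq_Ov_iff)
        \<comment> \<open>An earlier \<open>j\<close> would have larger size; at
          \<open>j = i\<close> the element lies in both \<open>A\<close> and \<open>B\<close> and
          the drop is at least 2; a later \<open>j\<close> has size at most that at
          \<open>Suc i\<close>.\<close>
        consider "j < i" | "j = i" | "i < j" by linarith
        then show False
        proof cases
          case 1
          then have "tail ?T i \<le> tail ?T (Suc j)" by (intro tail_antimono) auto
          moreover have "j \<in># ?T" using sub(4) j(1) by simp
          ultimately show False
            using tail_Suc_less[of j ?T] tail_Suc_less[OF \<open>i \<in># ?T\<close>] j(2) by simp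
        next
          case 2
          then show False
            using j i sub(2) by (simp add: tail_Suc[of ?T i] count_mset_set' count_eq_zero_iff)
        next
          case 3
          then show False
            using j(2) tail_antimono[of "Suc i" j ?T] by simp
        qed
      qed
    qed
    then show "fst x = {#} \<longleftrightarrow> (\<forall>k\<ge>1. Ov k \<le> of_conjugate x 1 \<longrightarrow> (\<exists>i\<ge>1. of_conjugate x i = Ov k))"
      by (simp add: x)
  qed
  moreover have "bij_betw (\<lambda>B. ({#}, B)) (Fpow {1..}) {x \<in> conjugates. fst x = {#}}"
    by (auto simp: bij_betw_def inj_on_def conjugates_def)
  ultimately have "bij_betw (of_conjugate \<circ> (\<lambda>B. ({#}, B))) (Fpow {1..}) partitions_F"
    by (rule bij_betw_trans[rotated])
  then show ?thesis
    by (simp add: comp_def)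
qed

lemma bij_betw_partitions_D:
  "bij_betw (\<lambda>(L, A). of_conjugate (A, {1..L})) (SIGMA L:UNIV. {A. set_mset A \<subseteq> {1..L}}) partitions_D"
proof -
  have "bij_betw of_conjugate {x \<in> conjugates. \<exists>L. snd x = {1..L} \<and> set_mset (fst x) \<subseteq> {1..L}} partitions_D"
    unfolding partitions_D_def
  proof (rule bij_betw_restrict[OF bij_betw_of_conjugate])
    fix x assume "x \<in> conjugates"
    then obtain A B where x: "x = (A, B)" and AB: "(A, B) \<in> conjugates" by (cases x) auto
    let ?l = "of_conjugate (A, B)" and ?T = "A + mset_set B"
    note sub = conjugatesD[OF AB]
    have "(\<exists>L. B = {1..L} \<and> set_mset A \<subseteq> {1..L}) \<longleftrightarrow> (\<forall>i\<ge>1. sz (?l i) > 0 \<longrightarrow> overlined (?l i))"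
    proof
      assume "\<exists>L. B = {1..L} \<and> set_mset A \<subseteq> {1..L}"
      then obtain L where L: "B = {1..L}" "set_mset A \<subseteq> {1..L}" by blast
      show "\<forall>i\<ge>1. sz (?l i) > 0 \<longrightarrow> overlined (?l i)"
      proof (intro allI impI)
        fix i :: nat assume "i \<ge> 1" "sz (?l i) > 0"
        then obtain j where "j \<in># ?T" "i \<le> j"
          by (auto simp: sz_of_conjugate tail_pos_iff)
        then show "overlined (?l i)"
          using L \<open>i \<ge> 1\<close> by (auto simp: overlined_of_conjugate)
      qed
    next
      assume *: "\<forall>i\<ge>1. sz (?l i) > 0 \<longrightarrow> overlined (?l i)"
      \<comment> \<open>The largest element of the conjugate, that is, the number of positive parts;
        inserting 0 covers the empty over-partition.\<close>
      define L where "L = Max (insert 0 (set_mset ?T))"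
      have "set_mset ?T \<subseteq> {1..L}"
        using sub by (auto simp: L_def)
      moreover have "{1..L} \<subseteq> B"
      proof
        fix i assume i: "i \<in> {1..L}"
        have "L \<in> insert 0 (set_mset ?T)"
          unfolding L_def by (rule Max_in) auto
        then have "tail ?T i > 0"
          using i by (auto simp: tail_pos_iff)
        then show "i \<in> B"
          using * i by (auto simp: sz_of_conjugate overlined_of_conjugate)
      qed
      ultimately show "\<exists>L. B = {1..L} \<and> set_mset A \<subseteq> {1..L}"
        unfolding sub(4) by (intro exI[of _ L]) auto
    qed
    then show "(\<exists>L. snd x = {1..L} \<and> set_mset (fst x) \<subseteq> {1..L})
        \<longleftrightarrow> (\<forall>i\<ge>1. sz (of_conjugate x i) > 0 \<longrightarrow> overlined (of_conjugate x i))"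
      by (simp add: x)
  qed
  moreover have "bij_betw (\<lambda>(L, A). (A, {1..L})) (SIGMA L:UNIV. {A. set_mset A \<subseteq> {1..L}})
      {x \<in> conjugates. \<exists>L. snd x = {1..L} \<and> set_mset (fst x) \<subseteq> {1..L}}"
    by (rule bij_betwI[where g = "\<lambda>(A, B). (card B, A)"]) (auto simp: conjugates_def Fpow_def)
  ultimately have "bij_betw (of_conjugate \<circ> (\<lambda>(L, A). (A, {1..L})))
      (SIGMA L:UNIV. {A. set_mset A \<subseteq> {1..L}}) partitions_D"
    by (rule bij_betw_trans[rotated])
  then show ?thesis
    by (simp add: comp_def case_prod_unfold)
qed


section \<open>Residue classes and the statistics\<close>

definition part_class :: "nat \<Rightarrow> nat \<Rightarrow> nat" where
  "part_class m k = (k - 1) mod m + 1"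

lemma part_class_bounds: "m \<ge> 1 \<Longrightarrow> part_class m k \<in> {1..m}"
  by (auto simp: part_class_def Suc_le_eq)

lemma part_class_eq_iff:
  assumes "j \<in> {1..m}" "k \<ge> 1"
  shows "part_class m k = j \<longleftrightarrow> k \<in> range (\<lambda>i. j + i * m)"
proof
  assume "part_class m k = j"
  then have "k = j + ((k - 1) div m) * m"
    using assms(2) div_mult_mod_eq[of "k - 1" m] unfolding part_class_def by linarith
  then show "k \<in> range (\<lambda>i. j + i * m)" by blast
next
  assume "k \<in> range (\<lambda>i. j + i * m)"
  then obtain i where "k = j + i * m" by blast
  then have "k - 1 = (j - 1) + i * m" using assms(1) by simp
  moreover have "((j - 1) + i * m) mod m = j - 1"
    unfolding mod_mult_self1 using assms(1) by (intro mod_less) auto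
  ultimately have "(k - 1) mod m = j - 1" by (simp only:)
  then show "part_class m k = j"
    using assms(1) by (simp add: part_class_def)
qed

lemma rho_of_conjugate:
  assumes AB: "(A, B) \<in> conjugates" and j: "j \<in> {1..m}"
  shows "rho m j (of_conjugate (A, B)) = size {#k \<in># A. part_class m k = j#}"
proof -
  let ?l = "of_conjugate (A, B)" and ?h = "\<lambda>i. j + i * m"
  let ?Z = "{i. ?l (?h i) \<noteq> Pl 0}"
  have inj: "inj ?h" using j by (auto simp: inj_on_def)
  have "finite {k. k \<ge> 1 \<and> ?l k \<noteq> Pl 0}"
    using of_conjugate_overpartition[OF AB] by (simp add: overpartitions_def)
  then have "finite (?h -` {k. k \<ge> 1 \<and> ?l k \<noteq> Pl 0})"
    using inj by (rule finite_vimageI)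
  then have fin: "finite ?Z"
    by (rule finite_subset[rotated]) (use j in auto)
  \<comment> \<open>Each summand is a genuine multiplicity, so the final \<open>nat\<close> in
    \<open>rho\<close> has no effect.\<close>
  have step: "int (sz (?l (?h i))) - int (sz (?l (j + 1 + i * m))) - (if overlined (?l (?h i)) then 1 else 0)
      = int (count A (?h i))" for i
    using count_of_conjugate[OF AB, of "?h i"] j by simp
  have "rho m j ?l = (\<Sum>i\<in>?Z. count A (?h i))"
    unfolding rho_def step by (simp flip: of_nat_sum)
  also have "\<dots> = (\<Sum>k\<in>?h ` ?Z. count A k)"
    using inj by (subst sum.reindex) (auto intro: inj_on_subset)
  \<comment> \<open>Nonzero multiplicity at a position forces a positive part there, so the two
    index sets differ only where the summand is 0.\<close>
  also have "\<dots> = (\<Sum>k\<in>{k. k \<in># A \<and> part_class m k = j}. count A k)"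
  proof (rule sum.mono_neutral_right)
    show "{k. k \<in># A \<and> part_class m k = j} \<subseteq> ?h ` ?Z"
    proof
      fix k assume "k \<in> {k. k \<in># A \<and> part_class m k = j}"
      then have k: "k \<in># A" "k \<ge> 1" "part_class m k = j"
        using conjugatesD(1)[OF AB] by auto
      then obtain i where i: "k = ?h i"
        using part_class_eq_iff[OF j, of k] by blast
      have "sz (?l k) > 0"
        using count_of_conjugate[OF AB k(2)] k(1) by simp
      then have "i \<in> ?Z" unfolding i by auto
      then show "k \<in> ?h ` ?Z" unfolding i by blast
    qed
    show "\<forall>k\<in>?h ` ?Z - {k. k \<in># A \<and> part_class m k = j}. count A k = 0"
    proof
      fix k assume k: "k \<in> ?h ` ?Z - {k. k \<in># A \<and> part_class m k = j}"
      then have "k \<in> range ?h" "k \<ge> 1" using j by auto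
      then have "part_class m k = j" using part_class_eq_iff[OF j] by simp
      then show "count A k = 0" using k by (simp add: not_in_iff)
    qed
  qed (use fin in auto)
  also have "\<dots> = size {#k \<in># A. part_class m k = j#}"
    by (simp add: size_multiset_overloaded_eq)
  finally show ?thesis .
qed

lemma rho_over_of_conjugate:
  assumes AB: "(A, B) \<in> conjugates" and j: "j \<in> {1..m}"
  shows "rho_over m j (of_conjugate (A, B)) = size {#k \<in># mset_set B. part_class m k = j#}"
proof -
  let ?h = "\<lambda>i. j + i * m"
  have "bij_betw ?h {i. overlined (of_conjugate (A, B) (?h i))} {k \<in> B. part_class m k = j}"
  proof (rule bij_betw_imageI)
    show "inj_on ?h {i. overlined (of_conjugate (A, B) (?h i))}"
      using j by (auto simp: inj_on_def)
    have "k \<in> ?h ` {i. ?h i \<in> B} \<longleftrightarrow> k \<in> B \<and> k \<in> range ?h" for k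
      by auto
    moreover have "overlined (of_conjugate (A, B) (?h i)) \<longleftrightarrow> ?h i \<in> B" for i
      using j by (simp add: overlined_of_conjugate)
    moreover have "k \<in> B \<Longrightarrow> part_class m k = j \<longleftrightarrow> k \<in> range ?h" for k
      using part_class_eq_iff[OF j, of k] conjugatesD(3)[OF AB] by (simp add: subset_iff)
    ultimately show "?h ` {i. overlined (of_conjugate (A, B) (?h i))} = {k \<in> B. part_class m k = j}"
      by (simp add: set_eq_iff) blast
  qed
  then show ?thesis
    using conjugatesD(2)[OF AB] by (simp add: rho_over_def bij_betw_same_card)
qed

lemma nsmul_0 [simp]: "nsmul 0 a = 0"
  by (simp add: nsmul_def)

lemma nsmul_Suc [simp]: "nsmul (Suc n) a = nsmul n a + a"
  by (simp add: nsmul_def)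

lemma nsmul_add: "nsmul (x + y) a = nsmul x a + nsmul y a"
  by (induction y) (simp_all add: ac_simps)

lemma sum_nsmul_tail:
  assumes "set_mset T \<subseteq> {..N}"
  shows "(\<Sum>k=1..N. nsmul (tail T k) (s k)) = (\<Sum>i\<in>#T. \<Sum>k=1..i. s k)"
  using assms
proof (induction T)
  case (add i T)
  have "(\<Sum>k=1..N. nsmul (tail (add_mset i T) k) (s k))
      = (\<Sum>k=1..N. nsmul (tail T k) (s k)) + (\<Sum>k=1..N. if k \<le> i then s k else 0)"
    unfolding sum.distrib[symmetric] by (rule sum.cong) (auto simp: tail_add_mset)
  also have "(\<Sum>k=1..N. if k \<le> i then s k else 0) = (\<Sum>k=1..i. s k)"
    using add.prems by (intro sum.mono_neutral_cong_right) auto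
  finally show ?case
    using add by (simp add: ac_simps)
qed (simp add: tail_def)

lemma wsize_of_conjugate:
  assumes AB: "(A, B) \<in> conjugates"
  shows "wsize s (of_conjugate (A, B))
    = (\<Sum>i\<in>#A. \<Sum>k=1..i. s k) + (\<Sum>i\<in>B. \<Sum>k=1..i. s k)"
proof -
  let ?l = "of_conjugate (A, B)" and ?T = "A + mset_set B"
  have fin: "finite {k. k \<ge> 1 \<and> ?l k \<noteq> Pl 0}"
    using of_conjugate_overpartition[OF AB] by (simp add: overpartitions_def)
  obtain N where N: "\<forall>i \<in> {k. k \<ge> 1 \<and> ?l k \<noteq> Pl 0} \<union> set_mset ?T. i \<le> N"
    using fin finite_nat_set_iff_bounded_le[of "{k. k \<ge> 1 \<and> ?l k \<noteq> Pl 0} \<union> set_mset ?T"] by auto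
  have "wsize s ?l = (\<Sum>k=1..N. nsmul (tail ?T k) (s k))"
    unfolding wsize_def
  proof (rule sum.mono_neutral_cong_left)
    show "\<forall>k\<in>{1..N} - {k. k \<ge> 1 \<and> ?l k \<noteq> Pl 0}. nsmul (tail ?T k) (s k) = 0"
    proof
      fix k assume "k \<in> {1..N} - {k. k \<ge> 1 \<and> ?l k \<noteq> Pl 0}"
      then have "tail ?T k = 0"
        using sz_of_conjugate[of k A B] by simp
      then show "nsmul (tail ?T k) (s k) = 0" by simp
    qed
  qed (use N in \<open>auto simp: sz_of_conjugate\<close>)
  also have "\<dots> = (\<Sum>i\<in>#?T. \<Sum>k=1..i. s k)"
    using N by (intro sum_nsmul_tail) auto
  also have "\<dots> = (\<Sum>i\<in>#A. \<Sum>k=1..i. s k) + (\<Sum>i\<in>B. \<Sum>k=1..i. s k)"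
    using conjugatesD(2)[OF AB] by (rule sum_mset_add_mset_set)
  finally show ?thesis .
qed

section \<open>Weights and q-Pochhammer symbols\<close>

text \<open>This carries finiteness from a family known to be summable to the factors of a product
  or quotient, whose indices embed into it with matching weights.\<close>

lemma finite_fibres_inj_on:
  assumes "finite_fibres w I" "inj_on h J" "h ` J \<subseteq> I" "\<And>j. j \<in> J \<Longrightarrow> v j = w (h j)"
  shows "finite_fibres v J"
  unfolding finite_fibres_def
proof
  fix z
  have "h ` {j \<in> J. v j = z} \<subseteq> {i \<in> I. w i = z}"
    using assms(3,4) by auto
  then have "finite (h ` {j \<in> J. v j = z})"
    using finite_fibresD[OF assms(1)] by (rule finite_subset)
  then show "finite {j \<in> J. v j = z}"
    by (rule finite_imageD) (rule inj_on_subset[OF assms(2)], auto)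
qed

lemma summable_on_bij_betw_monomials:
  assumes bij: "bij_betw h J I" and f: "\<And>j. j \<in> J \<Longrightarrow> f (h j) = lookup (Poly_Mapping.single (w j) 1)"
    and "f summable_on I"
  shows "finite_fibres w J"
proof (rule summable_on_finite_fibres)
  have "(\<lambda>j. f (h j)) summable_on J"
    using assms(3) summable_on_reindex_bij_betw[OF bij] by blast
  then show "(\<lambda>j. lookup (Poly_Mapping.single (w j) 1)) summable_on J"
    by (rule summable_on_cong[THEN iffD1, rotated]) (rule f)
qed

lemma has_sum_bij_betw_monomials:
  assumes bij: "bij_betw h J I" and f: "\<And>j. j \<in> J \<Longrightarrow> f (h j) = lookup (Poly_Mapping.single (w j) 1)"
    and fin: "finite_fibres w J"
  shows "(f has_sum gf (\<lambda>_. 1) w J) I"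
proof -
  have "((\<lambda>j. f (h j)) has_sum gf (\<lambda>_. 1) w J) J"
    using has_sum_gf[OF fin] by (rule has_sum_cong[THEN iffD2, rotated]) (rule f)
  then show ?thesis
    using has_sum_reindex_bij_betw[OF bij] by blast
qed

lemma gf_Collect_mem:
  assumes "finite_fibres w I" "finite Q"
  shows "gf c w {i \<in> I. q i \<in> Q} = (\<Sum>l\<in>Q. gf c w {i \<in> I. q i = l})"
proof
  fix z
  have "gf c w {i \<in> I. q i \<in> Q} z = (\<Sum>l\<in>Q. sum c {i \<in> {i \<in> {i \<in> I. q i \<in> Q}. w i = z}. q i = l})"
    unfolding gf_def
    using assms finite_fibresD[OF finite_fibres_subset[OF assms(1)], of "{i \<in> I. q i \<in> Q}"]
    by (intro sum.group[symmetric]) auto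
  also have "\<dots> = (\<Sum>l\<in>Q. gf c w {i \<in> I. q i = l} z)"
    unfolding gf_def by (intro sum.cong refl) auto
  finally show "gf c w {i \<in> I. q i \<in> Q} z = (\<Sum>l\<in>Q. gf c w {i \<in> I. q i = l}) z"
    by (simp add: sum_fun_apply)
qed

text \<open>A fixed monomial has a finite fibre and therefore meets only finitely many classes of
  \<open>p\<close>.\<close>

lemma has_sum_gf_partition:
  assumes "finite_fibres w I"
  shows "((\<lambda>n. gf c w {i \<in> I. p i = n}) has_sum gf c w I) UNIV"
  unfolding has_sum_fun_iff
proof
  fix z
  let ?F = "{i \<in> I. w i = z}"
  have fin: "finite ?F" using assms by (rule finite_fibresD)
  have fib: "gf c w {i \<in> I. p i = n} z = sum c {i \<in> ?F. p i = n}" for n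
    unfolding gf_def by (rule sum.cong) auto
  show "((\<lambda>n. gf c w {i \<in> I. p i = n} z) has_sum gf c w I z) UNIV"
  proof (rule has_sum_finite_support)
    show "gf c w {i \<in> I. p i = n} z = 0" if "n \<in> UNIV - p ` ?F" for n
    proof -
      have "{i \<in> ?F. p i = n} = {}" using that by auto
      then show ?thesis unfolding fib by (simp only: sum.empty)
    qed
    show "(\<Sum>n\<in>p ` ?F. gf c w {i \<in> I. p i = n} z) = gf c w I z"
      unfolding fib gf_def[of c w I] using fin by (rule sum.image_gen[symmetric])
  qed (use fin in auto)
qed

lemma bij_betw_Fpow_Un:
  assumes "K \<inter> K' = {}"
  shows "bij_betw (\<lambda>(C, D). C \<union> D) (Fpow K \<times> Fpow K') (Fpow (K \<union> K'))"
  by (rule bij_betwI[where g = "\<lambda>E. (E \<inter> K, E \<inter> K')"]) (use assms in \<open>auto simp: Fpow_def\<close>)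

lemma bij_betw_multisets_Un:
  assumes "K \<inter> K' = {}"
  shows "bij_betw (\<lambda>(A, A'). A + A') ({A. set_mset A \<subseteq> K} \<times> {A. set_mset A \<subseteq> K'}) {A. set_mset A \<subseteq> K \<union> K'}"
proof (rule bij_betwI[where g = "\<lambda>A. (filter_mset (\<lambda>k. k \<in> K) A, filter_mset (\<lambda>k. k \<notin> K) A)"])
  show "(filter_mset (\<lambda>k. k \<in> K) ((\<lambda>(A, A'). A + A') x), filter_mset (\<lambda>k. k \<notin> K) ((\<lambda>(A, A'). A + A') x)) = x"
    if mem: "x \<in> {A. set_mset A \<subseteq> K} \<times> {A. set_mset A \<subseteq> K'}" for x
  proof -
    obtain A A' where x: "x = (A, A')" "set_mset A \<subseteq> K" "set_mset A' \<subseteq> K'"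
      using mem by auto
    have "filter_mset (\<lambda>k. k \<in> K) A = A" "filter_mset (\<lambda>k. k \<notin> K) A = {#}"
      using x(2) by (auto simp: filter_mset_eq_conv)
    moreover have "filter_mset (\<lambda>k. k \<in> K) A' = {#}" "filter_mset (\<lambda>k. k \<notin> K) A' = A'"
      using x(3) assms by (auto simp: filter_mset_eq_conv)
    ultimately show ?thesis by (simp add: x)
  qed
qed (use assms in \<open>auto simp flip: multiset_partition\<close>)

section \<open>Color degree and the monomial of a single element\<close>

definition color_degree :: "'a mono \<Rightarrow> nat" where
  "color_degree p = (\<Sum>x\<in>Poly_Mapping.keys (fst p). Poly_Mapping.lookup (fst p) x)"

lemma color_degree_superset:
  assumes "finite X" "Poly_Mapping.keys (fst p) \<subseteq> X"
  shows "color_degree p = (\<Sum>x\<in>X. Poly_Mapping.lookup (fst p) x)"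
  unfolding color_degree_def using assms by (intro sum.mono_neutral_left) (auto simp: in_keys_iff)

lemma color_degree_add: "color_degree (p + q) = color_degree p + color_degree q"
proof -
  let ?X = "Poly_Mapping.keys (fst p) \<union> Poly_Mapping.keys (fst q)"
  have "color_degree (p + q) = (\<Sum>x\<in>?X. Poly_Mapping.lookup (fst (p + q)) x)"
    using Poly_Mapping.keys_add[of "fst p" "fst q"] by (intro color_degree_superset) auto
  also have "\<dots> = (\<Sum>x\<in>?X. Poly_Mapping.lookup (fst p) x) + (\<Sum>x\<in>?X. Poly_Mapping.lookup (fst q) x)"
    by (simp add: lookup_add sum.distrib)
  also have "\<dots> = color_degree p + color_degree q"
    by (subst (1 2) color_degree_superset[symmetric]) auto
  finally show ?thesis .
qed

lemma color_degree_0 [simp]: "color_degree 0 = 0"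
  by (simp add: color_degree_def)

definition part_mono :: "(nat \<Rightarrow> oint) \<Rightarrow> nat \<Rightarrow> (nat \<Rightarrow> 'a) \<Rightarrow> nat \<Rightarrow> 'a mono" where
  "part_mono g m S k = (Poly_Mapping.single (g (part_class m k)) 1, S k)"

lemma color_degree_part_mono [simp]: "color_degree (part_mono g m S k) = 1"
  by (simp add: color_degree_def part_mono_def)

lemma color_degree_sum_mset: "color_degree (\<Sum>k\<in>#A. part_mono g m S k) = size A"
  by (induction A) (simp_all add: color_degree_add)

lemma color_degree_sum: "color_degree (sum (part_mono g m S) B) = card B"
  by (induction B rule: infinite_finite_induct) (simp_all add: color_degree_add)

lemma qpow_0 [simp]: "qpow 0 = 1"
  by (simp add: qpow_def flip: zero_prod_def)

lemma qpow_add: "qpow (a + b) = qpow a * qpow b"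
  by (simp add: qpow_def mult_single)

lemma qpow_sum: "qpow (sum f X) = (\<Prod>x\<in>X. qpow (f x))"
  by (induction X rule: infinite_finite_induct) (simp_all add: qpow_add)

lemma col_mult_qpow: "col x * qpow a = Poly_Mapping.single (Poly_Mapping.single x 1, a) 1"
  by (simp add: col_def qpow_def mult_single)

lemma prod_part_class:
  assumes "m \<ge> 1"
  shows "(\<Prod>j=1..m. f j ^ size {#k \<in># A. part_class m k = j#}) = (\<Prod>k\<in>#A. f (part_class m k))"
proof (induction A)
  case (add a A)
  have "(\<Prod>j=1..m. f j ^ size {#k \<in># add_mset a A. part_class m k = j#})
      = (\<Prod>j=1..m. (if part_class m a = j then f j else 1) * f j ^ size {#k \<in># A. part_class m k = j#})"
    by (rule prod.cong) auto
  also have "\<dots> = f (part_class m a) * (\<Prod>k\<in>#A. f (part_class m k))"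
    unfolding prod.distrib add.IH using part_class_bounds[OF assms, of a] by simp
  finally show ?case by simp
qed simp

lemma prod_mset_col_mult_qpow:
  "(\<Prod>k\<in>#A. col (g (part_class m k))) * qpow (\<Sum>k\<in>#A. S k)
    = Poly_Mapping.single (\<Sum>k\<in>#A. part_mono g m S k) 1"
proof (induction A)
  case (add k A)
  have "(\<Prod>k\<in>#add_mset k A. col (g (part_class m k))) * qpow (\<Sum>k\<in>#add_mset k A. S k)
      = (col (g (part_class m k)) * qpow (S k))
        * ((\<Prod>k\<in>#A. col (g (part_class m k))) * qpow (\<Sum>k\<in>#A. S k))"
    by (simp add: qpow_add ac_simps)
  then show ?case
    unfolding add.IH col_mult_qpow by (simp add: mult_single part_mono_def[of g m S k])
qed (simp flip: zero_prod_def)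

lemma prod_col_mult_qpow:
  "(\<Prod>k\<in>#mset_set B. col (g (part_class m k))) * qpow (sum S B)
    = Poly_Mapping.single (sum (part_mono g m S) B) 1"
  using prod_mset_col_mult_qpow[of g m "mset_set B" S] by (simp add: sum_unfold_sum_mset)

section \<open>Index sets of the factors of q-Pochhammer symbols\<close>

definition residue_block :: "nat \<Rightarrow> nat set \<Rightarrow> nat \<Rightarrow> nat set" where
  "residue_block m J n = {k. k \<ge> 1 \<and> part_class m k \<in> J \<and> (k - 1) div m < n}"

lemma bij_betw_residue_block:
  assumes "J \<subseteq> {1..m}"
  shows "bij_betw (\<lambda>(j, i). j + i * m) (J \<times> {..<n}) (residue_block m J n)"
proof (rule bij_betwI[where g = "\<lambda>k. (part_class m k, (k - 1) div m)"])
  have inv: "part_class m (j + i * m) = j" "(j + i * m - 1) div m = i" if "j \<in> J" for i j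
  proof -
    have j: "j \<in> {1..m}" using that assms by blast
    then show "part_class m (j + i * m) = j"
      using part_class_eq_iff[OF j] by auto
    have "j + i * m - 1 = (j - 1) + i * m" using j by simp
    moreover have "((j - 1) + i * m) div m = i" using j by (subst div_mult_self1) auto
    ultimately show "(j + i * m - 1) div m = i" by (simp only:)
  qed
  show "(\<lambda>(j, i). j + i * m) \<in> J \<times> {..<n} \<rightarrow> residue_block m J n"
    using inv assms by (fastforce simp: residue_block_def)
  show "(part_class m ((\<lambda>(j, i). j + i * m) x), ((\<lambda>(j, i). j + i * m) x - 1) div m) = x"
    if "x \<in> J \<times> {..<n}" for x
    using that inv by auto
  show "(\<lambda>(j, i). j + i * m) (part_class m k, (k - 1) div m) = k" if "k \<in> residue_block m J n" for k
    using that div_mult_mod_eq[of "k - 1" m] by (simp add: residue_block_def part_class_def)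
qed (auto simp: residue_block_def)

lemma prod_residue_block:
  assumes "J \<subseteq> {1..m}"
  shows "(\<Prod>k\<in>residue_block m J n. f k) = (\<Prod>j\<in>J. \<Prod>i<n. f (j + i * m))"
  by (simp add: prod.reindex_bij_betw[OF bij_betw_residue_block[OF assms], symmetric]
      prod.cartesian_product case_prod_unfold)

lemma finite_residue_block: "J \<subseteq> {1..m} \<Longrightarrow> finite (residue_block m J n)"
  using bij_betw_finite[OF bij_betw_residue_block, of J m n] finite_subset[of J "{1..m}"] by simp

text \<open>The quotients \<open>(k - 1) div m\<close> are bounded on a finite set. Thus the index
  family of an infinite product is the increasing union of those of its finite truncations.\<close>

lemma Fpow_residue_class:
  "Fpow {k. k \<ge> 1 \<and> part_class m k \<in> J} = (\<Union>n. Fpow (residue_block m J n))"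
proof (intro equalityI subsetI)
  fix C assume C: "C \<in> Fpow {k. k \<ge> 1 \<and> part_class m k \<in> J}"
  then have "finite ((\<lambda>k. (k - 1) div m) ` C)" by (simp add: Fpow_def)
  then obtain n where "\<forall>i\<in>(\<lambda>k. (k - 1) div m) ` C. i < n"
    unfolding finite_nat_set_iff_bounded by blast
  then have "C \<in> Fpow (residue_block m J n)"
    using C by (auto simp: Fpow_def residue_block_def)
  then show "C \<in> (\<Union>n. Fpow (residue_block m J n))" by blast
qed (auto simp: Fpow_def residue_block_def)

lemma atLeastAtMost_residue_blocks:
  assumes "m \<ge> 1" "l \<in> {1..m}"
  shows "residue_block m {1..<l} (n + 1) \<union> residue_block m {l..m} n = {1..n * m + (l - 1)}"
    and "residue_block m {1..<l} (n + 1) \<inter> residue_block m {l..m} n = {}"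
proof -
  have "k \<in> residue_block m {1..<l} (n + 1) \<union> residue_block m {l..m} n \<longleftrightarrow> k \<in> {1..n * m + (l - 1)}" for k
  proof -
    define i r where "i = (k - 1) div m" and "r = (k - 1) mod m"
    have k: "k - 1 = i * m + r" and r: "r < m"
      using assms(1) by (auto simp: i_def r_def)
    have "k - 1 < n * m + (l - 1) \<longleftrightarrow> i < n \<or> (i = n \<and> r < l - 1)"
    proof (cases i n rule: linorder_cases)
      case less
      then have "(i + 1) * m \<le> n * m" by (intro mult_right_mono) auto
      then show ?thesis using less k r by simp
    next
      case greater
      then have "(n + 1) * m \<le> i * m" by (intro mult_right_mono) auto
      moreover have "l - 1 \<le> m" using assms(2) by auto
      ultimately have "n * m + (l - 1) \<le> k - 1" unfolding k by simp
      then show ?thesis using greater by simp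
    next
      case equal
      then show ?thesis unfolding k by simp
    qed
    moreover have "k \<in> residue_block m {1..<l} (n + 1) \<union> residue_block m {l..m} n
        \<longleftrightarrow> k \<ge> 1 \<and> (i < n \<or> (i = n \<and> r < l - 1))"
      unfolding residue_block_def part_class_def Un_iff mem_Collect_eq i_def[symmetric] r_def[symmetric]
      using r by auto
    ultimately show ?thesis by auto
  qed
  then show "residue_block m {1..<l} (n + 1) \<union> residue_block m {l..m} n = {1..n * m + (l - 1)}"
    by blast
qed (auto simp: residue_block_def)

lemma nsmul_nsmul: "nsmul x (nsmul y a) = nsmul (x * y) a"
  by (induction x) (simp_all add: nsmul_add ac_simps)

lemma sum_nsmul_lessThan: "(\<Sum>i<n. nsmul i a) = nsmul (n * (n - 1) div 2) a"
proof (induction n)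
  case (Suc n)
  have "Suc n * (Suc n - 1) div 2 = n * (n - 1) div 2 + n"
    by (cases n) (auto simp: algebra_simps)
  then show ?case using Suc by (simp add: nsmul_add)
qed simp

lemma sum_const_nsmul: "(\<Sum>x\<in>X. a) = nsmul (card X) a"
  by (induction X rule: infinite_finite_induct) (simp_all add: ac_simps)

text \<open>The color degree bounds the size of \<open>A\<close>, and a finite set carries finitely
  many multisets of each size. No condition on the monoid enters.\<close>

lemma finite_fibres_multisets:
  assumes "finite K"
  shows "finite_fibres (\<lambda>A. (\<Sum>k\<in>#A. part_mono g m S k) + c) {A. set_mset A \<subseteq> K}"
  unfolding finite_fibres_def
proof
  fix z
  have "{A \<in> {A. set_mset A \<subseteq> K}. (\<Sum>k\<in>#A. part_mono g m S k) + c = z}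
      \<subseteq> (\<Union>n\<le>color_degree z. multisets_of_size K n)"
    by (auto simp: multisets_of_size_def color_degree_add color_degree_sum_mset)
  then show "finite {A \<in> {A. set_mset A \<subseteq> K}. (\<Sum>k\<in>#A. part_mono g m S k) + c = z}"
    by (rule finite_subset) (use assms in \<open>auto intro: finite_multisets_of_size\<close>)
qed

lemma single_div_signed_sets:
  fixes u :: "'n \<Rightarrow> 'k::comm_monoid_add" and deg :: "'k \<Rightarrow> nat"
  assumes deg_add: "\<And>x y. deg (x + y) = deg x + deg y"
    and deg_u: "\<And>k. k \<in> K \<Longrightarrow> deg (u k) > 0"
    and fin: "finite_fibres (\<lambda>A. (\<Sum>k\<in>#A. u k) + c) {A. set_mset A \<subseteq> K}"
  shows "lookup (Poly_Mapping.single c 1) \<oslash> gf (\<lambda>C. (- 1) ^ card C) (sum u) (Fpow K)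
    = gf (\<lambda>_. 1) (\<lambda>A. (\<Sum>k\<in>#A. u k) + c) {A. set_mset A \<subseteq> K}"
proof -
  let ?X = "{A. set_mset A \<subseteq> K}"
  \<comment> \<open>A numerator consisting of one monomial is a family indexed by the one-element
    type.\<close>
  let ?w = "\<lambda>(A, b :: unit). (\<Sum>k\<in>#A. u k) + c"
  have bij: "bij_betw (\<lambda>A. (A, ())) ?X (?X \<times> UNIV)"
    by (auto simp: bij_betw_def inj_on_def)
  have "finite_fibres ?w (?X \<times> UNIV)"
    using fin finite_fibres_bij_betw[OF bij, of ?w] by simp
  then have "gf (\<lambda>_. 1) (\<lambda>_. c) (UNIV :: unit set) \<oslash> gf (\<lambda>C. (- 1) ^ card C) (sum u) (Fpow K)
      = gf (\<lambda>(A, b). 1) ?w (?X \<times> UNIV)"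
    by (intro gf_div_signed_sets[where v = "\<lambda>_. c" and d = "\<lambda>_. 1", OF deg_add deg_u])
  moreover have "gf (\<lambda>(A, b). 1) ?w (?X \<times> UNIV) = gf (\<lambda>_. 1) (\<lambda>A. (\<Sum>k\<in>#A. u k) + c) ?X"
    using gf_bij_betw[OF bij, of "\<lambda>(A, b). 1" ?w] by simp
  moreover have "lookup (Poly_Mapping.single c 1) = gf (\<lambda>_. 1) (\<lambda>_. c) (UNIV :: unit set)"
    using lookup_sum_single[of "UNIV :: unit set" "\<lambda>_. c" "\<lambda>_. 1"] by simp
  ultimately show ?thesis by simp
qed

lemma qpochs_inf_Cons: "qpochs_inf (a # as) t = qpoch_inf a t \<star> qpochs_inf as t"
  by (simp add: qpochs_inf_def)

section \<open>Periodic weights: q-Pochhammer symbols as generating functions\<close>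

context
  fixes m :: nat and s S :: "nat \<Rightarrow> 'a::comm_monoid_add"
  assumes m: "m \<ge> 1"
    and periodic: "\<And>i. i \<ge> 1 \<Longrightarrow> s (i + m) = s i"
    and S: "\<And>i. S i = (\<Sum>k=1..i. s k)"
begin

lemma S_add_period: "S (k + m) = S k + S m"
proof (induction k)
  case (Suc k)
  have "S (Suc k + m) = S (k + m) + s (Suc k + m)" by (simp add: S ac_simps)
  then show ?case using periodic[of "Suc k"] Suc by (simp add: S ac_simps)
qed (simp add: S)

lemma S_add_mult_period: "S (k + i * m) = S k + nsmul i (S m)"
proof (induction i)
  case (Suc i)
  have eq: "k + Suc i * m = (k + i * m) + m" by simp
  show ?case unfolding eq S_add_period Suc nsmul_Suc by (simp only: ac_simps)
qed simp

lemma part_mono_add_mult: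
  assumes "j \<in> {1..m}"
  shows "part_mono g m S (j + i * m) = (Poly_Mapping.single (g j) 1, S j + nsmul i (S m))"
  using part_class_eq_iff[OF assms, of "j + i * m"] assms
  by (simp add: part_mono_def S_add_mult_period)

lemma monomial_of_conjugate:
  assumes AB: "(A, B) \<in> conjugates"
  shows "(\<Prod>j=1..m. col (Pl j) ^ rho m j (of_conjugate (A, B))) = (\<Prod>k\<in>#A. col (Pl (part_class m k)))"
    and "(\<Prod>j=1..m. col (Ov j) ^ rho_over m j (of_conjugate (A, B)))
      = (\<Prod>k\<in>#mset_set B. col (Ov (part_class m k)))"
    and "qpow (wsize s (of_conjugate (A, B))) = qpow (\<Sum>k\<in>#A. S k) * qpow (sum S B)"
  by (simp_all add: rho_of_conjugate[OF AB] rho_over_of_conjugate[OF AB] wsize_of_conjugate[OF AB]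
      prod_part_class[OF m, of "\<lambda>j. col (Pl j)", simplified] prod_part_class[OF m, of "\<lambda>j. col (Ov j)", simplified] S[abs_def] qpow_add)

lemma full_monomial_of_conjugate:
  assumes AB: "(A, B) \<in> conjugates"
  shows "(\<Prod>j=1..m. col (Pl j) ^ rho m j (of_conjugate (A, B)) * col (Ov j) ^ rho_over m j (of_conjugate (A, B)))
      * qpow (wsize s (of_conjugate (A, B)))
    = Poly_Mapping.single ((\<Sum>k\<in>#A. part_mono Pl m S k) + sum (part_mono Ov m S) B) 1"
proof -
  have "Poly_Mapping.single ((\<Sum>k\<in>#A. part_mono Pl m S k) + sum (part_mono Ov m S) B) (1::int)
      = ((\<Prod>k\<in>#A. col (Pl (part_class m k))) * qpow (\<Sum>k\<in>#A. S k))
        * ((\<Prod>k\<in>#mset_set B. col (Ov (part_class m k))) * qpow (sum S B))"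
    unfolding prod_mset_col_mult_qpow prod_col_mult_qpow by (simp add: mult_single)
  then show ?thesis
    unfolding prod.distrib monomial_of_conjugate[OF AB] by (simp only: ac_simps)
qed

lemma qpochs_eq_prod:
  assumes "distinct js" "set js \<subseteq> {1..m}"
  shows "qpochs (map (\<lambda>j. Poly_Mapping.single (Poly_Mapping.single (g j) 1, S j) (- e)) js) (S m) n
    = (\<Prod>k\<in>residue_block m (set js) n. 1 + Poly_Mapping.single (part_mono g m S k) e)"
proof -
  have "qpochs (map (\<lambda>j. Poly_Mapping.single (Poly_Mapping.single (g j) 1, S j) (- e)) js) (S m) n
      = (\<Prod>j\<in>set js. qpoch (Poly_Mapping.single (Poly_Mapping.single (g j) 1, S j) (- e)) (S m) n)"
    unfolding qpochs_def using assms(1) by (simp add: prod.distinct_set_conv_list comp_def)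
  also have "\<dots> = (\<Prod>j\<in>set js. \<Prod>i<n. 1 + Poly_Mapping.single (part_mono g m S (j + i * m)) e)"
    using assms(2) unfolding qpoch_def
    by (intro prod.cong refl)
       (auto simp: part_mono_add_mult qpow_def mult_single single_uminus subset_iff)
  finally show ?thesis
    by (simp add: prod_residue_block[OF assms(2)])
qed

lemma lookup_qpochs:
  assumes "distinct js" "set js \<subseteq> {1..m}"
  shows "lookup (qpochs (map (\<lambda>j. Poly_Mapping.single (Poly_Mapping.single (g j) 1, S j) (- e)) js) (S m) n)
    = gf (\<lambda>C. e ^ card C) (sum (part_mono g m S)) (Fpow (residue_block m (set js) n))"
proof -
  have "Fpow (residue_block m (set js) n) = Pow (residue_block m (set js) n)"
    using finite_residue_block[OF assms(2)] by (auto simp: Fpow_def intro: finite_subset)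
  then show ?thesis
    unfolding qpochs_eq_prod[OF assms]
    by (simp add: lookup_prod_add_single finite_residue_block[OF assms(2)])
qed

lemma qpoch_inf_eq_gf:
  assumes j: "j \<in> {1..m}"
    and fin: "finite_fibres (sum (part_mono g m S)) (Fpow {k. k \<ge> 1 \<and> part_class m k = j})"
  shows "qpoch_inf (Poly_Mapping.single (Poly_Mapping.single (g j) 1, S j) (- e)) (S m)
    = gf (\<lambda>C. e ^ card C) (sum (part_mono g m S)) (Fpow {k. k \<ge> 1 \<and> part_class m k = j})"
proof -
  let ?a = "Poly_Mapping.single (Poly_Mapping.single (g j) 1, S j) (- e)"
  have classes: "Fpow {k. k \<ge> 1 \<and> part_class m k = j} = (\<Union>n. Fpow (residue_block m {j} n))"
    using Fpow_residue_class[of m "{j}"] by simp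
  have "lookup (qpoch ?a (S m) n) = gf (\<lambda>C. e ^ card C) (sum (part_mono g m S)) (Fpow (residue_block m {j} n))" for n
    using lookup_qpochs[of "[j]" g e n] j by (simp add: qpochs_def)
  moreover have "incseq (\<lambda>n. Fpow (residue_block m {j} n))"
    by (intro incseq_SucI Fpow_mono) (auto simp: residue_block_def)
  ultimately show ?thesis
    unfolding qpoch_inf_def classes using fin gf_tendsto_UN unfolding classes by (auto intro!: series_lim_eqI)
qed

text \<open>The infinite symbol is a nested Cauchy product, each stage of which must exist.
  Finiteness is therefore assumed for all classes together and handed down through disjoint
  unions.\<close>

lemma qpochs_inf_eq_gf:
  assumes "distinct js" "set js \<subseteq> {1..m}"
    and "finite_fibres (sum (part_mono g m S)) (Fpow {k. k \<ge> 1 \<and> part_class m k \<in> set js})"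
  shows "qpochs_inf (map (\<lambda>j. Poly_Mapping.single (Poly_Mapping.single (g j) 1, S j) (- e)) js) (S m)
    = gf (\<lambda>C. e ^ card C) (sum (part_mono g m S)) (Fpow {k. k \<ge> 1 \<and> part_class m k \<in> set js})"
  using assms
proof (induction js)
  case Nil
  have "lookup 1 = gf (\<lambda>C. e ^ card C) (sum (part_mono g m S)) {{}}"
    using lookup_sum_single[of "{{}}" "sum (part_mono g m S)" "\<lambda>C. e ^ card C"] by simp
  moreover have "Fpow {} = {{} :: nat set}" by (auto simp: Fpow_def)
  ultimately show ?case by (simp add: qpochs_inf_def)
next
  case (Cons j js)
  let ?w = "sum (part_mono g m S)"
  let ?K = "{k. k \<ge> 1 \<and> part_class m k = j}" and ?K' = "{k. k \<ge> 1 \<and> part_class m k \<in> set js}"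
  have un: "{k. k \<ge> 1 \<and> part_class m k \<in> set (j # js)} = ?K \<union> ?K'" by auto
  have disj: "?K \<inter> ?K' = {}" using Cons.prems(1) by auto
  have bij: "bij_betw (\<lambda>(C, D). C \<union> D) (Fpow ?K \<times> Fpow ?K') (Fpow (?K \<union> ?K'))"
    using disj by (rule bij_betw_Fpow_Un)
  have fin: "finite_fibres ?w (Fpow (?K \<union> ?K'))"
    using Cons.prems(3) unfolding un .
  have fin1: "finite_fibres ?w (Fpow ?K)" and fin2: "finite_fibres ?w (Fpow ?K')"
    by (rule finite_fibres_subset[OF fin], rule Fpow_mono, blast)+
  have dj: "C \<inter> D = {}" "finite C" "finite D" if "C \<in> Fpow ?K" "D \<in> Fpow ?K'" for C D
    using that disj by (auto simp: Fpow_def)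
  have w: "?w (C \<union> D) = ?w C + ?w D" and c: "e ^ card (C \<union> D) = e ^ card C * e ^ card D"
    if "C \<in> Fpow ?K" "D \<in> Fpow ?K'" for C D
    using dj[OF that] by (simp_all add: sum.union_disjoint card_Un_disjoint power_add)
  have finP: "finite_fibres (\<lambda>(C, D). ?w C + ?w D) (Fpow ?K \<times> Fpow ?K')"
    by (rule finite_fibres_inj_on[OF fin bij_betw_imp_inj_on[OF bij]])
       (use bij_betw_imp_surj_on[OF bij] w in auto)
  have "qpochs_inf (map (\<lambda>j. Poly_Mapping.single (Poly_Mapping.single (g j) 1, S j) (- e)) (j # js)) (S m)
      = gf (\<lambda>C. e ^ card C) ?w (Fpow ?K) \<star> gf (\<lambda>C. e ^ card C) ?w (Fpow ?K')"
    using Cons.prems Cons.IH fin2 qpoch_inf_eq_gf[OF _ fin1] by (simp add: qpochs_inf_Cons)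
  also have "\<dots> = gf (\<lambda>(C, D). e ^ card C * e ^ card D) (\<lambda>(C, D). ?w C + ?w D) (Fpow ?K \<times> Fpow ?K')"
    using finP by (rule gf_mult)
  also have "\<dots> = gf (\<lambda>p. e ^ card (case p of (C, D) \<Rightarrow> C \<union> D)) (\<lambda>p. ?w (case p of (C, D) \<Rightarrow> C \<union> D))
      (Fpow ?K \<times> Fpow ?K')"
    by (rule gf_cong) (auto simp: w c)
  also have "\<dots> = gf (\<lambda>C. e ^ card C) ?w (Fpow (?K \<union> ?K'))"
    using bij by (rule gf_bij_betw)
  finally show ?case unfolding un .
qed

lemma qpochs_inf_all_eq_gf:
  assumes "finite_fibres (sum (part_mono g m S)) (Fpow {1..})"
  shows "qpochs_inf (map (\<lambda>j. Poly_Mapping.single (Poly_Mapping.single (g j) 1, S j) (- e)) [1..<m+1]) (S m)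
    = gf (\<lambda>C. e ^ card C) (sum (part_mono g m S)) (Fpow {1..})"
proof -
  have "{k. k \<ge> 1 \<and> part_class m k \<in> set [1..<m+1]} = {1..}"
    using part_class_bounds[OF m] by fastforce
  moreover have "set [1..<m+1] \<subseteq> {1..m}" by auto
  ultimately show ?thesis
    using qpochs_inf_eq_gf[of "[1..<m+1]" g e, OF distinct_upt] assms by (simp only:)
qed

lemma prod_col_power_mult_qpow:
  assumes J: "J \<subseteq> {1..m}"
  shows "(\<Prod>j\<in>J. col (g j)) ^ n * qpow (nsmul n (\<Sum>j\<in>J. S j) + nsmul (card J * n * (n - 1) div 2) (S m))
    = Poly_Mapping.single (sum (part_mono g m S) (residue_block m J n)) 1"
proof -
  \<comment> \<open>Truncating division by 2 commutes with the factor \<open>card J\<close> because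
    \<open>n * (n - 1)\<close> is even.\<close>
  have "even (n * (n - 1))" by (cases "even n") auto
  then have "card J * n * (n - 1) div 2 = card J * (n * (n - 1) div 2)"
    unfolding mult.assoc by (rule div_mult_swap[symmetric])
  then have exponent: "nsmul n (\<Sum>j\<in>J. S j) + nsmul (card J * n * (n - 1) div 2) (S m)
      = (\<Sum>j\<in>J. \<Sum>i<n. S j + nsmul i (S m))"
    by (simp add: sum.distrib sum_nsmul_lessThan sum_const_nsmul nsmul_nsmul)
       (simp add: nsmul_def sum.swap[of _ J])
  have "Poly_Mapping.single (sum (part_mono g m S) (residue_block m J n)) 1
      = (\<Prod>j\<in>J. \<Prod>i<n. Poly_Mapping.single (part_mono g m S (j + i * m)) (1::int))"
    using prod_single[of "part_mono g m S" 1 "residue_block m J n"] by (simp add: prod_residue_block[OF J])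
  also have "\<dots> = (\<Prod>j\<in>J. \<Prod>i<n. col (g j) * qpow (S j + nsmul i (S m)))"
    using J by (intro prod.cong refl) (auto simp: part_mono_add_mult col_mult_qpow subset_iff)
  also have "\<dots> = (\<Prod>j\<in>J. col (g j)) ^ n * qpow (\<Sum>j\<in>J. \<Sum>i<n. S j + nsmul i (S m))"
    by (simp add: prod.distrib qpow_sum prod_power_distrib)
  finally show ?thesis unfolding exponent ..
qed

lemma monomial_div_qpochs:
  assumes js: "distinct js" "set js \<subseteq> {1..m}"
  shows "lookup ((\<Prod>j\<in>set js. col (Ov j)) ^ n
      * qpow (nsmul n (\<Sum>j\<in>set js. S j) + nsmul (card (set js) * n * (n - 1) div 2) (S m)))
      \<oslash> lookup (qpochs (map (\<lambda>j. col (Pl j) * qpow (S j)) js) (S m) n)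
    = gf (\<lambda>_. 1) (\<lambda>A. (\<Sum>k\<in>#A. part_mono Pl m S k) + sum (part_mono Ov m S) (residue_block m (set js) n))
        {A. set_mset A \<subseteq> residue_block m (set js) n}"
proof -
  let ?K = "residue_block m (set js) n"
  have "lookup (qpochs (map (\<lambda>j. col (Pl j) * qpow (S j)) js) (S m) n)
      = gf (\<lambda>C. (- 1) ^ card C) (sum (part_mono Pl m S)) (Fpow ?K)"
    using lookup_qpochs[OF js, of Pl "- 1" n] by (simp add: col_mult_qpow)
  then show ?thesis
    unfolding prod_col_power_mult_qpow[OF js(2)]
    using single_div_signed_sets[of color_degree ?K "part_mono Pl m S",
        OF color_degree_add _ finite_fibres_multisets[OF finite_residue_block[OF js(2)]]]
    by (simp only: color_degree_part_mono zero_less_one)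
qed

text \<open>The two quotients range over multisets on two disjoint finite blocks whose union is
  \<open>{1..n * m + (l - 1)}\<close>. Finiteness of the blocks makes both quotients and their
  product exist unconditionally.\<close>

lemma partitions_D_summand:
  assumes l: "l \<in> {1..m}"
  shows "(lookup ((\<Prod>j=1..<l. col (Ov j)) ^ (n + 1)
                  * qpow (nsmul (n + 1) (\<Sum>j=1..<l. S j)
                          + nsmul ((l - 1) * n * (n + 1) div 2) (S m)))
          \<oslash> lookup (qpochs (map (\<lambda>j. col (Pl j) * qpow (S j)) [1..<l]) (S m) (n + 1)))
         \<star>
         (lookup ((\<Prod>j=l..m. col (Ov j)) ^ n
                  * qpow (nsmul n (\<Sum>j=l..m. S j)
                          + nsmul ((m - l + 1) * n * (n - 1) div 2) (S m)))
          \<oslash> lookup (qpochs (map (\<lambda>j. col (Pl j) * qpow (S j)) [l..<m+1]) (S m) n))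
    = gf (\<lambda>_. 1) (\<lambda>A. (\<Sum>k\<in>#A. part_mono Pl m S k) + sum (part_mono Ov m S) {1..n * m + (l - 1)})
        {A. set_mset A \<subseteq> {1..n * m + (l - 1)}}"
proof -
  let ?K = "residue_block m {1..<l} (n + 1)" and ?K' = "residue_block m {l..m} n"
  let ?w = "\<lambda>K A. (\<Sum>k\<in>#A. part_mono Pl m S k) + sum (part_mono Ov m S) K"
  let ?M = "\<lambda>K. {A :: nat multiset. set_mset A \<subseteq> K}"
  have J: "{1..<l} \<subseteq> {1..m}" "{l..m} \<subseteq> {1..m}" using l by auto
  have set: "set [1..<l] = {1..<l}" "set [l..<m+1] = {l..m}" by auto
  note blocks = atLeastAtMost_residue_blocks[OF m l, of n]
  \<comment> \<open>The first block has \<open>n + 1\<close> layers, so the triangular number for it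
    is \<open>(n + 1) * n div 2\<close>.\<close>
  have "card {1..<l} * (n + 1) * (n + 1 - 1) = (l - 1) * n * (n + 1)"
    by (simp add: ac_simps)
  then have X: "lookup ((\<Prod>j=1..<l. col (Ov j)) ^ (n + 1)
                  * qpow (nsmul (n + 1) (\<Sum>j=1..<l. S j) + nsmul ((l - 1) * n * (n + 1) div 2) (S m)))
          \<oslash> lookup (qpochs (map (\<lambda>j. col (Pl j) * qpow (S j)) [1..<l]) (S m) (n + 1))
      = gf (\<lambda>_. 1) (?w ?K) (?M ?K)"
    using monomial_div_qpochs[of "[1..<l]" "n + 1", OF distinct_upt, unfolded set, OF J(1)] by (simp only:)
  have "card {l..m} = m - l + 1" using l by (simp add: Suc_diff_le)
  then have Y: "lookup ((\<Prod>j=l..m. col (Ov j)) ^ n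
                  * qpow (nsmul n (\<Sum>j=l..m. S j) + nsmul ((m - l + 1) * n * (n - 1) div 2) (S m)))
          \<oslash> lookup (qpochs (map (\<lambda>j. col (Pl j) * qpow (S j)) [l..<m+1]) (S m) n)
      = gf (\<lambda>_. 1) (?w ?K') (?M ?K')"
    using monomial_div_qpochs[of "[l..<m+1]" n, OF distinct_upt, unfolded set, OF J(2)] by (simp only:)
  have finK: "finite ?K" "finite ?K'" by (rule finite_residue_block[OF J(1)], rule finite_residue_block[OF J(2)])
  have bij: "bij_betw (\<lambda>(A, A'). A + A') (?M ?K \<times> ?M ?K') (?M (?K \<union> ?K'))"
    using blocks(2) by (rule bij_betw_multisets_Un)
  have w: "?w ?K A + ?w ?K' A' = ?w (?K \<union> ?K') (A + A')" for A A'
    using finK blocks(2) by (simp add: sum.union_disjoint ac_simps)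
  have fin: "finite_fibres (?w (?K \<union> ?K')) (?M (?K \<union> ?K'))"
    using finK by (intro finite_fibres_multisets) auto
  have finP: "finite_fibres (\<lambda>(A, A'). ?w ?K A + ?w ?K' A') (?M ?K \<times> ?M ?K')"
    by (rule finite_fibres_inj_on[OF fin bij_betw_imp_inj_on[OF bij]])
       (use bij_betw_imp_surj_on[OF bij] w in auto)
  have "gf (\<lambda>_. 1) (?w ?K) (?M ?K) \<star> gf (\<lambda>_. 1) (?w ?K') (?M ?K')
      = gf (\<lambda>(A, A'). 1 * 1) (\<lambda>(A, A'). ?w ?K A + ?w ?K' A') (?M ?K \<times> ?M ?K')"
    using finP by (rule gf_mult)
  also have "\<dots> = gf (\<lambda>p. 1) (\<lambda>p. ?w (?K \<union> ?K') (case p of (A, A') \<Rightarrow> A + A')) (?M ?K \<times> ?M ?K')"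
    unfolding w by (rule gf_cong) auto
  also have "\<dots> = gf (\<lambda>_. 1) (?w (?K \<union> ?K')) (?M (?K \<union> ?K'))"
    using bij by (rule gf_bij_betw)
  finally show ?thesis
    unfolding X Y blocks(1) .
qed

section \<open>The four identities\<close>

lemma has_sum_overpartitions:
  fixes f
  defines "f \<equiv> \<lambda>lam. lookup ((\<Prod>j=1..m. col (Pl j) ^ rho m j lam * col (Ov j) ^ rho_over m j lam)
      * qpow (wsize s lam))"
  assumes "f summable_on overpartitions"
  shows "(f has_sum
      (qpochs_inf (map (\<lambda>j. - col (Ov j) * qpow (S j)) [1..<m+1]) (S m)
       \<oslash> qpochs_inf (map (\<lambda>j. col (Pl j) * qpow (S j)) [1..<m+1]) (S m))) overpartitions"
proof -
  let ?u = "part_mono Pl m S" and ?v = "sum (part_mono Ov m S)"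
  let ?w = "\<lambda>(A, B). (\<Sum>k\<in>#A. ?u k) + ?v B"
  have f: "f (of_conjugate x) = lookup (Poly_Mapping.single (?w x) 1)" if "x \<in> conjugates" for x
    using full_monomial_of_conjugate[of "fst x" "snd x"] that by (simp add: f_def case_prod_unfold)
  have fin: "finite_fibres ?w conjugates"
    using bij_betw_of_conjugate f assms(2) by (rule summable_on_bij_betw_monomials)
  have "finite_fibres ?v (Fpow {1..})"
    by (rule finite_fibres_inj_on[OF fin, of "\<lambda>B. ({#}, B)"]) (auto simp: inj_on_def conjugates_def)
  then have num: "qpochs_inf (map (\<lambda>j. - col (Ov j) * qpow (S j)) [1..<m+1]) (S m)
      = gf (\<lambda>_. 1) ?v (Fpow {1..})"
    using qpochs_inf_all_eq_gf[of Ov 1] by (simp add: col_mult_qpow single_uminus)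
  \<comment> \<open>A set in the expansion of the denominator is a multiset without repetition,
    hence occurs among the indices on the left with \<open>B = {}\<close>.\<close>
  have "finite_fibres (sum ?u) (Fpow {1..})"
    by (rule finite_fibres_inj_on[OF fin, of "\<lambda>C. (mset_set C, {})"])
       (auto simp: inj_on_def conjugates_def Fpow_def sum_unfold_sum_mset)
  then have den: "qpochs_inf (map (\<lambda>j. col (Pl j) * qpow (S j)) [1..<m+1]) (S m)
      = gf (\<lambda>C. (- 1) ^ card C) (sum ?u) (Fpow {1..})"
    using qpochs_inf_all_eq_gf[of Pl "- 1"] by (simp add: col_mult_qpow)
  have "gf (\<lambda>_. 1) ?v (Fpow {1..}) \<oslash> gf (\<lambda>C. (- 1) ^ card C) (sum ?u) (Fpow {1..})
      = gf (\<lambda>(A, B). 1) ?w conjugates"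
    using fin unfolding conjugates_def
    by (intro gf_div_signed_sets[where deg = color_degree and v = ?v and d = "\<lambda>_. 1"])
       (simp_all add: color_degree_add)
  then have "qpochs_inf (map (\<lambda>j. - col (Ov j) * qpow (S j)) [1..<m+1]) (S m)
      \<oslash> qpochs_inf (map (\<lambda>j. col (Pl j) * qpow (S j)) [1..<m+1]) (S m) = gf (\<lambda>_. 1) ?w conjugates"
    unfolding num den by (simp add: case_prod_unfold)
  then show ?thesis
    using has_sum_bij_betw_monomials[of of_conjugate conjugates overpartitions f ?w,
        OF bij_betw_of_conjugate f fin] by (simp only:)
qed

lemma has_sum_partitions_P:
  fixes f
  defines "f \<equiv> \<lambda>lam. lookup ((\<Prod>j=1..m. col (Pl j) ^ rho m j lam) * qpow (wsize s lam))"
  assumes "f summable_on partitions_P"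
  shows "(f has_sum
      (lookup 1 \<oslash> qpochs_inf (map (\<lambda>j. col (Pl j) * qpow (S j)) [1..<m+1]) (S m))) partitions_P"
proof -
  let ?u = "part_mono Pl m S"
  let ?w = "\<lambda>A. \<Sum>k\<in>#A. ?u k"
  let ?X = "{A. set_mset A \<subseteq> {1..}}"
  have f: "f (of_conjugate (A, {})) = lookup (Poly_Mapping.single (?w A) 1)" if "A \<in> ?X" for A
  proof -
    have AB: "(A, {}) \<in> conjugates" using that by (simp add: conjugates_def empty_in_Fpow)
    show ?thesis
      unfolding f_def monomial_of_conjugate[OF AB] by (simp add: prod_mset_col_mult_qpow)
  qed
  have fin: "finite_fibres ?w ?X"
    using bij_betw_partitions_P f assms(2) by (rule summable_on_bij_betw_monomials)
  have "finite_fibres (sum ?u) (Fpow {1..})"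
    by (rule finite_fibres_inj_on[OF fin, of mset_set])
       (auto simp: inj_on_def Fpow_def sum_unfold_sum_mset)
  then have den: "qpochs_inf (map (\<lambda>j. col (Pl j) * qpow (S j)) [1..<m+1]) (S m)
      = gf (\<lambda>C. (- 1) ^ card C) (sum ?u) (Fpow {1..})"
    using qpochs_inf_all_eq_gf[of Pl "- 1"] by (simp add: col_mult_qpow)
  have "lookup 1 \<oslash> qpochs_inf (map (\<lambda>j. col (Pl j) * qpow (S j)) [1..<m+1]) (S m) = gf (\<lambda>_. 1) ?w ?X"
    unfolding den using single_div_signed_sets[of color_degree "{1..}" ?u 0] fin
    by (simp add: color_degree_add)
  then show ?thesis
    using has_sum_bij_betw_monomials[of _ ?X partitions_P f ?w, OF bij_betw_partitions_P f fin]
    by (simp only:)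
qed

lemma has_sum_partitions_F:
  fixes f
  defines "f \<equiv> \<lambda>lam. lookup ((\<Prod>j=1..m. col (Ov j) ^ rho_over m j lam) * qpow (wsize s lam))"
  assumes "f summable_on partitions_F"
  shows "(f has_sum (qpochs_inf (map (\<lambda>j. - col (Ov j) * qpow (S j)) [1..<m+1]) (S m))) partitions_F"
proof -
  let ?w = "sum (part_mono Ov m S)"
  have f: "f (of_conjugate ({#}, B)) = lookup (Poly_Mapping.single (?w B) 1)" if "B \<in> Fpow {1..}" for B
  proof -
    have AB: "({#}, B) \<in> conjugates" using that by (simp add: conjugates_def)
    show ?thesis
      unfolding f_def monomial_of_conjugate[OF AB] by (simp add: prod_col_mult_qpow)
  qed
  have fin: "finite_fibres ?w (Fpow {1..})"
    using bij_betw_partitions_F f assms(2) by (rule summable_on_bij_betw_monomials)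
  then have "qpochs_inf (map (\<lambda>j. - col (Ov j) * qpow (S j)) [1..<m+1]) (S m)
      = gf (\<lambda>_. 1) ?w (Fpow {1..})"
    using qpochs_inf_all_eq_gf[of Ov 1] by (simp add: col_mult_qpow single_uminus)
  then show ?thesis
    using has_sum_bij_betw_monomials[of _ "Fpow {1..}" partitions_F f ?w, OF bij_betw_partitions_F f fin]
    by (simp only:)
qed

lemma has_sum_partitions_D:
  "((\<lambda>lam. lookup ((\<Prod>j=1..m. col (Pl j) ^ rho m j lam * col (Ov j) ^ rho_over m j lam)
                     * qpow (wsize s lam)))
       has_sum
      series_sum (\<lambda>n. \<Sum>l=1..m.
         (lookup ((\<Prod>j=1..<l. col (Ov j)) ^ (n + 1)
                  * qpow (nsmul (n + 1) (\<Sum>j=1..<l. S j)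
                          + nsmul ((l - 1) * n * (n + 1) div 2) (S m)))
          \<oslash> lookup (qpochs (map (\<lambda>j. col (Pl j) * qpow (S j)) [1..<l]) (S m) (n + 1)))
         \<star>
         (lookup ((\<Prod>j=l..m. col (Ov j)) ^ n
                  * qpow (nsmul n (\<Sum>j=l..m. S j)
                          + nsmul ((m - l + 1) * n * (n - 1) div 2) (S m)))
          \<oslash> lookup (qpochs (map (\<lambda>j. col (Pl j) * qpow (S j)) [l..<m+1]) (S m) n)))
        UNIV) partitions_D"
    (is "(?f has_sum series_sum ?T UNIV) partitions_D")
proof -
  define w where "w = (\<lambda>(L, A). (\<Sum>k\<in>#A. part_mono Pl m S k) + sum (part_mono Ov m S) {1..L :: nat})"
  define D where "D = (SIGMA L:UNIV :: nat set. {A :: nat multiset. set_mset A \<subseteq> {1..L}})"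
  define h where "h = (\<lambda>(L :: nat, A). of_conjugate (A, {1..L}))"
  have bij: "bij_betw h D partitions_D"
    unfolding h_def D_def by (rule bij_betw_partitions_D)
  have f: "?f (h x) = lookup (Poly_Mapping.single (w x) 1)" if "x \<in> D" for x
  proof -
    obtain L A where x: "x = (L, A)" by fastforce
    have "(A, {1..L}) \<in> conjugates"
      using that by (auto simp: x D_def conjugates_def Fpow_def)
    then show ?thesis
      by (simp only: x h_def w_def prod.case full_monomial_of_conjugate)
  qed
  have slice: "bij_betw (Pair L) {A. set_mset A \<subseteq> {1..L}} {x \<in> D. fst x = L}" for L
    by (auto simp: bij_betw_def inj_on_def D_def)
  have fin: "finite_fibres w D"
    unfolding finite_fibres_def
  proof
    fix z
    \<comment> \<open>The color degree of \<open>w (L, A)\<close> is \<open>size A + L\<close>,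
      which bounds both \<open>L\<close> and the size of \<open>A\<close>.\<close>
    have "{x \<in> D. w x = z} \<subseteq> (SIGMA L:{..color_degree z}. \<Union>n\<le>color_degree z. multisets_of_size {1..L} n)"
      by (auto simp: D_def w_def multisets_of_size_def color_degree_add color_degree_sum_mset color_degree_sum)
    then show "finite {x \<in> D. w x = z}"
      by (rule finite_subset) (auto intro!: finite_SigmaI finite_multisets_of_size)
  qed
  have "?T n = gf (\<lambda>_. 1) w {x \<in> D. fst x div m = n}" for n
  proof -
    have "?T n = (\<Sum>l=1..m. gf (\<lambda>_. 1) w {x \<in> D. fst x = n * m + (l - 1)})"
    proof (rule sum.cong)
      fix l assume "l \<in> {1..m}"
      then show "(lookup ((\<Prod>j=1..<l. col (Ov j)) ^ (n + 1)
                  * qpow (nsmul (n + 1) (\<Sum>j=1..<l. S j)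
                          + nsmul ((l - 1) * n * (n + 1) div 2) (S m)))
          \<oslash> lookup (qpochs (map (\<lambda>j. col (Pl j) * qpow (S j)) [1..<l]) (S m) (n + 1)))
         \<star>
         (lookup ((\<Prod>j=l..m. col (Ov j)) ^ n
                  * qpow (nsmul n (\<Sum>j=l..m. S j)
                          + nsmul ((m - l + 1) * n * (n - 1) div 2) (S m)))
          \<oslash> lookup (qpochs (map (\<lambda>j. col (Pl j) * qpow (S j)) [l..<m+1]) (S m) n))
        = gf (\<lambda>_. 1) w {x \<in> D. fst x = n * m + (l - 1)}"
        unfolding partitions_D_summand[OF \<open>l \<in> {1..m}\<close>]
        using gf_bij_betw[OF slice, where c = "\<lambda>_. 1" and w = w] by (simp only: w_def prod.case)
    qed simp
    \<comment> \<open>With \<open>L = n * m + (l - 1)\<close>, the values \<open>l = 1..m\<close>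
      run through all \<open>L\<close> with \<open>L div m = n\<close>.\<close>
    also have "\<dots> = (\<Sum>L\<in>{n * m..<n * m + m}. gf (\<lambda>_. 1) w {x \<in> D. fst x = L})"
      by (rule sum.reindex_bij_witness[where i = "\<lambda>L. L - n * m + 1" and j = "\<lambda>l. n * m + (l - 1)"]) auto
    also have "\<dots> = gf (\<lambda>_. 1) w {x \<in> D. fst x \<in> {n * m..<n * m + m}}"
      by (rule gf_Collect_mem[OF fin, symmetric]) simp
    also have "{x \<in> D. fst x \<in> {n * m..<n * m + m}} = {x \<in> D. fst x div m = n}"
      using m div_nat_eqI[of n m] by (auto simp: div_nat_eqI dividend_less_times_div ac_simps)
    finally show ?thesis .
  qed
  then have "(?T has_sum gf (\<lambda>_. 1) w D) UNIV"
    using has_sum_gf_partition[OF fin] by (simp only:)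
  then have "series_sum ?T UNIV = gf (\<lambda>_. 1) w D"
    by (rule series_sum_eqI)
  then show ?thesis
    using has_sum_bij_betw_monomials[of h D partitions_D ?f w, OF bij f fin] by (simp only:)
qed

end

theorem theorem1p14:
  fixes m :: nat
    and s :: "nat \<Rightarrow> 'a::comm_monoid_add"
    and S :: "nat \<Rightarrow> 'a"
  assumes m: "m \<ge> 1"
    and periodic: "\<And>i. i \<ge> 1 \<Longrightarrow> s (i + m) = s i"
    and S: "\<And>i. S i = (\<Sum>k=1..i. s k)"
  shows
    "((\<lambda>lam. lookup ((\<Prod>j=1..m. col (Pl j) ^ rho m j lam * col (Ov j) ^ rho_over m j lam)
                     * qpow (wsize s lam)))
       summable_on overpartitions \<longrightarrow>
     ((\<lambda>lam. lookup ((\<Prod>j=1..m. col (Pl j) ^ rho m j lam * col (Ov j) ^ rho_over m j lam)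
                     * qpow (wsize s lam)))
       has_sum
      (qpochs_inf (map (\<lambda>j. - col (Ov j) * qpow (S j)) [1..<m+1]) (S m)
       \<oslash> qpochs_inf (map (\<lambda>j. col (Pl j) * qpow (S j)) [1..<m+1]) (S m)))
     overpartitions)
     \<and>
     ((\<lambda>lam. lookup ((\<Prod>j=1..m. col (Pl j) ^ rho m j lam) * qpow (wsize s lam)))
       summable_on partitions_P \<longrightarrow>
     ((\<lambda>lam. lookup ((\<Prod>j=1..m. col (Pl j) ^ rho m j lam) * qpow (wsize s lam)))
       has_sum
      (lookup 1 \<oslash> qpochs_inf (map (\<lambda>j. col (Pl j) * qpow (S j)) [1..<m+1]) (S m)))
     partitions_P)
     \<and>
     ((\<lambda>lam. lookup ((\<Prod>j=1..m. col (Ov j) ^ rho_over m j lam) * qpow (wsize s lam)))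
       summable_on partitions_F \<longrightarrow>
     ((\<lambda>lam. lookup ((\<Prod>j=1..m. col (Ov j) ^ rho_over m j lam) * qpow (wsize s lam)))
       has_sum
      (qpochs_inf (map (\<lambda>j. - col (Ov j) * qpow (S j)) [1..<m+1]) (S m)))
     partitions_F)
     \<and>
     ((\<lambda>lam. lookup ((\<Prod>j=1..m. col (Pl j) ^ rho m j lam * col (Ov j) ^ rho_over m j lam)
                     * qpow (wsize s lam)))
       has_sum
      series_sum (\<lambda>n. \<Sum>l=1..m.
         (lookup ((\<Prod>j=1..<l. col (Ov j)) ^ (n + 1)
                  * qpow (nsmul (n + 1) (\<Sum>j=1..<l. S j)
                          + nsmul ((l - 1) * n * (n + 1) div 2) (S m)))
          \<oslash> lookup (qpochs (map (\<lambda>j. col (Pl j) * qpow (S j)) [1..<l]) (S m) (n + 1)))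
         \<star>
         (lookup ((\<Prod>j=l..m. col (Ov j)) ^ n
                  * qpow (nsmul n (\<Sum>j=l..m. S j)
                          + nsmul ((m - l + 1) * n * (n - 1) div 2) (S m)))
          \<oslash> lookup (qpochs (map (\<lambda>j. col (Pl j) * qpow (S j)) [l..<m+1]) (S m) n)))
        UNIV)
     partitions_D"
  using has_sum_overpartitions[OF assms] has_sum_partitions_P[OF assms]
    has_sum_partitions_F[OF assms] has_sum_partitions_D[OF assms]
  by (intro conjI impI)

end
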